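(* Let $\lambda>0$. There is one and only one solution $u:\Gamma\to\mathbb{R}$ of the discounted Hamilton--Jacobi problem on the network $\Gamma$, and its restriction to $\mathbf{V}$ coincides with the function $$U(x)=\inf\{\rho(f(\mathrm{o}(\xi)),\xi):\ \xi\text{ path with }\mathrm{t}(\xi)=x\},\qquad x\in\mathbf{V},$$ where $f(x)=\inf\{\beta(\xi):\xi\text{ cycle based on }x\}$ for $x\in\mathbf{V}$.
   Context: Network: $\Gamma=\bigcup_{\gamma\in\mathcal{E}}\gamma([0,1])\subset\mathbb{R}^N$, where $\mathcal{E}$ is a finite collection of regular simple curves $\gamma:[0,1]\to\mathbb{R}^N$ (arcs; closed arcs with $\gamma(0)=\gamma(1)$, and several arcs joining the same points, are allowed). For each arc $\gamma$ the inverse arc $-\gamma$, $(-\gamma)(s)=\gamma(1-s)$, also belongs to $\mathcal{E}$ and is regarded as distinct from $\gamma$; and $\gamma((0,1))\cap\gamma'([0,1])=\emptyset$ whenever $\gamma\ne\pm\gamma'$. $\mathbf{V}$ is the (finite) set of vertices, i.e. of initial and terminal points of arcs. $\Gamma$ is connected: any two vertices are linked by a finite concatenation of arcs. Hamiltonians: for each $\gamma\in\mathcal{E}$, $H_\gamma:[0,1]\times\mathbb{R}\to\mathbb{R}$ is continuous in $(s,p)$, coercive in $p$ ($H_\gamma(s,p)\to+\infty$ as $|p|\to\infty$, uniformly in $s$), and $H_{-\gamma}(s,p)=H_\gamma(1-s,-p)$. No convexity is assumed. Equation on an arc: (E$_\gamma$) $\lambda w+H_\gamma(s,w')=0$ in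 $(0,1)$; sub/super/solutions are continuous functions on $[0,1]$ satisfying it in the viscosity sense in $(0,1)$. A continuous $w$ on $[0,1]$ satisfies the state constraint boundary condition for (E$_\gamma$) at $s=1$ if $\lambda\varphi(1)+H_\gamma(1,\varphi'(1))\ge 0$ for every $C^1$ function $\varphi$ with $\varphi(1)=w(1)$ and $w\ge\varphi$ in $(1-\delta,1)$ for some $\delta>0$. Problem on $\Gamma$: a subsolution is a continuous $u:\Gamma\to\mathbb{R}$ such that $u\circ\gamma$ is a subsolution of (E$_\gamma$) for every $\gamma\in\mathcal{E}$. A supersolution is a continuous $u:\Gamma\to\mathbb{R}$ such that $u\circ\gamma$ is a supersolution of (E$_\gamma$) for every $\gamma\in\mathcal{E}$ and, for every vertex $x$, there is at least one arc $\gamma$ with $\gamma(1)=x$ such that $u\circ\gamma$ satisfies the state constraint boundary condition for (E$_\gamma$) at $s=1$. A solution is both a subsolution and a supersolution. Graph: $\mathbf{E}$ is an abstract set with a bijection $\Psi:\mathbf{E}\to\mathcal{E}$; for $e\in\mathbf{E}$ put $\mathrm{o}(e)=\Psi(e)(0)$, $-e=\Psi^{-1}(-\Psi(e))$, $\mathrm{t}(e)=\mathrm{o}(-e)=\Psi(e)(1)$. For $\alpha\in\mathbb{R}$ and $\gamma\in\mathcal{E}$ let $u_\alpha^\gamma(s)=\sup\{w(s): w$ subsolution of (E$_\gamma$) with $w(0)\le\alpha\}$, $s\in[0,1]$, and set $\rho(\alpha,e)=u_\alpha^{\Psi(e)}(1)$. Paths: a path is a finite sequence $\xi=(e_i)_{i=1}^M$,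 $M\ge1$, of edges with $\mathrm{t}(e_j)=\mathrm{o}(e_{j+1})$; $\mathrm{o}(\xi)=\mathrm{o}(e_1)$, $\mathrm{t}(\xi)=\mathrm{t}(e_M)$. It is a cycle, based on $\mathrm{o}(\xi)$, if $\mathrm{o}(\xi)=\mathrm{t}(\xi)$. The function $\rho$ is extended to paths inductively by $\rho(\alpha,(e_i)_{i=1}^M)=\rho\big(\rho(\alpha,(e_i)_{i=1}^{M-1}),e_M\big)$. For a cycle $\xi$, $\beta(\xi)$ denotes the unique $\alpha\in\mathbb{R}$ with $\rho(\alpha,\xi)=\alpha$ (existence and uniqueness are known). *)

theory Defs
  imports "HOL-Analysis.Analysis"
begin

section \<open>Networks\<close>

text \<open>
  A curve is a function on the unit interval, so arcs are taken in \<^term>\<open>extensional {0..1}\<close>: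
  equality of arcs is then equality on the unit interval, and a set of arcs is an honest set of
  curves. All conditions below look at an arc only inside the unit interval; in particular
  derivatives at the end points are one-sided. The predicate \<^const>\<open>simple_path\<close> allows closed
  curves.
\<close>

definition regular_simple_curve :: "(real \<Rightarrow> real^'n) \<Rightarrow> bool" where
  "regular_simple_curve \<gamma> \<longleftrightarrow>
     \<gamma> \<in> extensional {0..1} \<and> simple_path \<gamma> \<and>
     (\<exists>\<gamma>'. continuous_on {0..1} \<gamma>' \<and>
           (\<forall>s\<in>{0..1}. (\<gamma> has_vector_derivative \<gamma>' s) (at s within {0..1}) \<and> \<gamma>' s \<noteq> 0))"

definition inverse_arc :: "(real \<Rightarrow> real^'n) \<Rightarrow> real \<Rightarrow> real^'n" where
  "inverse_arc \<gamma> = restrict (reversepath \<gamma>) {0..1}"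

definition vertices :: "(real \<Rightarrow> real^'n) set \<Rightarrow> (real^'n) set" where
  "vertices A = pathstart ` A \<union> pathfinish ` A"

definition carrier_of :: "(real \<Rightarrow> real^'n) set \<Rightarrow> (real^'n) set" where
  "carrier_of A = (\<Union>\<gamma>\<in>A. path_image \<gamma>)"

text \<open>
  Nonempty finite chains from \<open>x\<close> to \<open>y\<close>, used both for concatenations of arcs and for paths of
  edges; \<open>src\<close> and \<open>tgt\<close> give the end points of a single link.
\<close>

definition chain_from_to ::
    "('e \<Rightarrow> 'v) \<Rightarrow> ('e \<Rightarrow> 'v) \<Rightarrow> 'e set \<Rightarrow> 'v \<Rightarrow> 'e list \<Rightarrow> 'v \<Rightarrow> bool" where
  "chain_from_to src tgt A x es y \<longleftrightarrow>
     es \<noteq> [] \<and> set es \<subseteq> A \<and> successively (\<lambda>d e. tgt d = src e) es \<and>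
     src (hd es) = x \<and> tgt (last es) = y"

definition network :: "(real \<Rightarrow> real^'n) set \<Rightarrow> bool" where
  "network A \<longleftrightarrow>
     finite A \<and>
     (\<forall>\<gamma>\<in>A. regular_simple_curve \<gamma>) \<and>
     (\<forall>\<gamma>\<in>A. inverse_arc \<gamma> \<in> A) \<and>
     (\<forall>\<gamma>\<in>A. \<forall>\<gamma>'\<in>A. \<gamma> \<noteq> \<gamma>' \<and> \<gamma> \<noteq> inverse_arc \<gamma>' \<longrightarrow>
        \<gamma> ` {0<..<1} \<inter> \<gamma>' ` {0..1} = {}) \<and>
     (\<forall>x\<in>vertices A. \<forall>y\<in>vertices A. \<exists>\<gamma>s. chain_from_to pathstart pathfinish A x \<gamma>s y)"

definition hamiltonians ::
    "(real \<Rightarrow> real^'n) set \<Rightarrow> ((real \<Rightarrow> real^'n) \<Rightarrow> real \<Rightarrow> real \<Rightarrow> real) \<Rightarrow> bool" where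
  "hamiltonians A H \<longleftrightarrow>
     (\<forall>\<gamma>\<in>A. continuous_on ({0..1} \<times> UNIV) (\<lambda>(s, p). H \<gamma> s p)) \<and>
     (\<forall>\<gamma>\<in>A. \<forall>C. \<forall>\<^sub>F p in at_infinity. \<forall>s\<in>{0..1}. H \<gamma> s p \<ge> C) \<and>
     (\<forall>\<gamma>\<in>A. \<forall>s\<in>{0..1}. \<forall>p. H (inverse_arc \<gamma>) s p = H \<gamma> (1 - s) (- p))"


section \<open>The discounted equation on an arc\<close>

text \<open>
  Viscosity sub- and supersolutions of \<open>lam * w + h s w' = 0\<close> in the open unit interval, for a
  single Hamiltonian \<open>h\<close>. Test functions are C1 on the whole line; since only their local behaviour
  matters, this is no restriction compared with test functions that are C1 near the contact point.
\<close>

definition arc_subsolution :: "real \<Rightarrow> (real \<Rightarrow> real \<Rightarrow> real) \<Rightarrow> (real \<Rightarrow> real) \<Rightarrow> bool" where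
  "arc_subsolution lam h w \<longleftrightarrow>
     continuous_on {0..1} w \<and>
     (\<forall>\<phi>. \<forall>s\<in>{0<..<1}. \<phi> C1_differentiable_on UNIV \<longrightarrow>
        (\<forall>\<^sub>F t in at s. w t - \<phi> t \<le> w s - \<phi> s) \<longrightarrow>
        lam * w s + h s (deriv \<phi> s) \<le> 0)"

definition arc_supersolution :: "real \<Rightarrow> (real \<Rightarrow> real \<Rightarrow> real) \<Rightarrow> (real \<Rightarrow> real) \<Rightarrow> bool" where
  "arc_supersolution lam h w \<longleftrightarrow>
     continuous_on {0..1} w \<and>
     (\<forall>\<phi>. \<forall>s\<in>{0<..<1}. \<phi> C1_differentiable_on UNIV \<longrightarrow>
        (\<forall>\<^sub>F t in at s. w t - \<phi> t \<ge> w s - \<phi> s) \<longrightarrow>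
        lam * w s + h s (deriv \<phi> s) \<ge> 0)"

definition state_constraint_at_1 ::
    "real \<Rightarrow> (real \<Rightarrow> real \<Rightarrow> real) \<Rightarrow> (real \<Rightarrow> real) \<Rightarrow> bool" where
  "state_constraint_at_1 lam h w \<longleftrightarrow>
     (\<forall>\<phi>. \<phi> C1_differentiable_on UNIV \<longrightarrow> \<phi> 1 = w 1 \<longrightarrow>
        (\<exists>\<delta>>0. \<forall>t\<in>{1 - \<delta><..<1}. w t \<ge> \<phi> t) \<longrightarrow>
        lam * \<phi> 1 + h 1 (deriv \<phi> 1) \<ge> 0)"


section \<open>The discounted problem on a network\<close>

definition network_subsolution ::
    "real \<Rightarrow> (real \<Rightarrow> real^'n) set \<Rightarrow> ((real \<Rightarrow> real^'n) \<Rightarrow> real \<Rightarrow> real \<Rightarrow> real) \<Rightarrow>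
     (real^'n \<Rightarrow> real) \<Rightarrow> bool" where
  "network_subsolution lam A H u \<longleftrightarrow>
     continuous_on (carrier_of A) u \<and>
     (\<forall>\<gamma>\<in>A. arc_subsolution lam (H \<gamma>) (u \<circ> \<gamma>))"

definition network_supersolution ::
    "real \<Rightarrow> (real \<Rightarrow> real^'n) set \<Rightarrow> ((real \<Rightarrow> real^'n) \<Rightarrow> real \<Rightarrow> real \<Rightarrow> real) \<Rightarrow>
     (real^'n \<Rightarrow> real) \<Rightarrow> bool" where
  "network_supersolution lam A H u \<longleftrightarrow>
     continuous_on (carrier_of A) u \<and>
     (\<forall>\<gamma>\<in>A. arc_supersolution lam (H \<gamma>) (u \<circ> \<gamma>)) \<and>
     (\<forall>x\<in>vertices A. \<exists>\<gamma>\<in>A. \<gamma> 1 = x \<and> state_constraint_at_1 lam (H \<gamma>) (u \<circ> \<gamma>))"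

definition network_solution ::
    "real \<Rightarrow> (real \<Rightarrow> real^'n) set \<Rightarrow> ((real \<Rightarrow> real^'n) \<Rightarrow> real \<Rightarrow> real \<Rightarrow> real) \<Rightarrow>
     (real^'n \<Rightarrow> real) \<Rightarrow> bool" where
  "network_solution lam A H u \<longleftrightarrow>
     network_subsolution lam A H u \<and> network_supersolution lam A H u"


section \<open>The underlying graph and the discrete value function\<close>

text \<open>
  \<open>E\<close> is the edge set and \<open>\<Psi>\<close> its bijection onto the arcs.

  The real-valued suprema and infima below are over nonempty bounded sets when \<open>lam > 0\<close> and the
  Hamiltonians are continuous and coercive. For \<open>max_subsolution\<close>: sufficiently negative constants
  are subsolutions, and a subsolution is at most \<open>- m / lam\<close> for a lower bound \<open>m\<close> of the
  Hamiltonian. For the infima: there is an \<open>a\<close> with \<open>rho lam H \<Psi> b e > min a b\<close> for all \<open>b\<close> and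
  all edges \<open>e\<close>, so \<open>a\<close> bounds all competitors from below; and an edge followed by its inverse
  is a cycle.
\<close>

definition max_subsolution :: "real \<Rightarrow> (real \<Rightarrow> real \<Rightarrow> real) \<Rightarrow> real \<Rightarrow> real \<Rightarrow> real" where
  "max_subsolution lam h \<alpha> s = Sup {w s | w. arc_subsolution lam h w \<and> w 0 \<le> \<alpha>}"

definition rho ::
    "real \<Rightarrow> ((real \<Rightarrow> real^'n) \<Rightarrow> real \<Rightarrow> real \<Rightarrow> real) \<Rightarrow> ('e \<Rightarrow> real \<Rightarrow> real^'n) \<Rightarrow>
     real \<Rightarrow> 'e \<Rightarrow> real" where
  "rho lam H \<Psi> \<alpha> e = max_subsolution lam (H (\<Psi> e)) \<alpha> 1"

definition rho_path ::
    "real \<Rightarrow> ((real \<Rightarrow> real^'n) \<Rightarrow> real \<Rightarrow> real \<Rightarrow> real) \<Rightarrow> ('e \<Rightarrow> real \<Rightarrow> real^'n) \<Rightarrow>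
     real \<Rightarrow> 'e list \<Rightarrow> real" where
  "rho_path lam H \<Psi> \<alpha> \<xi> = foldl (rho lam H \<Psi>) \<alpha> \<xi>"

definition edge_path ::
    "'e set \<Rightarrow> ('e \<Rightarrow> real \<Rightarrow> real^'n) \<Rightarrow> real^'n \<Rightarrow> 'e list \<Rightarrow> real^'n \<Rightarrow> bool" where
  "edge_path E \<Psi> x \<xi> y \<longleftrightarrow> chain_from_to (\<lambda>e. \<Psi> e 0) (\<lambda>e. \<Psi> e 1) E x \<xi> y"

definition beta ::
    "real \<Rightarrow> ((real \<Rightarrow> real^'n) \<Rightarrow> real \<Rightarrow> real \<Rightarrow> real) \<Rightarrow> ('e \<Rightarrow> real \<Rightarrow> real^'n) \<Rightarrow>
     'e list \<Rightarrow> real" where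
  "beta lam H \<Psi> \<xi> = (THE \<alpha>. rho_path lam H \<Psi> \<alpha> \<xi> = \<alpha>)"

definition cycle_inf ::
    "real \<Rightarrow> ((real \<Rightarrow> real^'n) \<Rightarrow> real \<Rightarrow> real \<Rightarrow> real) \<Rightarrow> 'e set \<Rightarrow>
     ('e \<Rightarrow> real \<Rightarrow> real^'n) \<Rightarrow> real^'n \<Rightarrow> real" where
  "cycle_inf lam H E \<Psi> x = Inf {beta lam H \<Psi> \<xi> | \<xi>. edge_path E \<Psi> x \<xi> x}"

definition vertex_value ::
    "real \<Rightarrow> ((real \<Rightarrow> real^'n) \<Rightarrow> real \<Rightarrow> real \<Rightarrow> real) \<Rightarrow> 'e set \<Rightarrow>
     ('e \<Rightarrow> real \<Rightarrow> real^'n) \<Rightarrow> real^'n \<Rightarrow> real" where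
  "vertex_value lam H E \<Psi> x =
     Inf {rho_path lam H \<Psi> (cycle_inf lam H E \<Psi> y) \<xi> | y \<xi>. edge_path E \<Psi> y \<xi> x}"

end

theory Submission
  imports Defs
begin

text \<open>
  Everything rests on a comparison principle on a single arc. By coercivity a subsolution \<open>w\<close> is
  Lipschitz continuous. If \<open>v\<close> is a supersolution and \<open>w - v\<close> is maximal at \<open>s0\<close>, where either \<open>s0\<close>
  is interior or \<open>s0 = 1\<close> and \<open>v\<close> satisfies the state constraint there, then \<open>w s0 \<le> v s0\<close>
  (\<open>comparison_at_maximum\<close>): double the variables with a penalty whose shift keeps the variable of
  the subsolution away from the end point. On a network the end point \<open>0\<close> never has to be treated,
  because every vertex is the terminal point of an arc on which the supersolution satisfies the state
  constraint. Applied at a maximum point of the difference of two solutions this gives uniqueness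
  (\<open>network_comparison\<close>).

  Existence is Perron's method. The supremum of all subsolutions above a low constant is a
  subsolution, since subsolutions bounded below are equi-Lipschitz (\<open>subsolution_Sup\<close>). If it failed
  to be a supersolution inside an arc, it could be raised near the point of failure. If the state
  constraint failed on every arc that ends at some vertex, it could be raised by one and the same
  amount at the end of all these arcs, which yields a function on the network again. Either way
  maximality is contradicted (\<open>network_solution_exists\<close>).

  For the vertex values, let \<open>u\<close> be the solution. Along each edge \<open>u\<close> itself competes in the
  supremum that defines \<open>rho\<close>, so \<open>u y \<le> rho_path (u x) \<xi>\<close> for every path \<open>\<xi>\<close> from \<open>x\<close> to \<open>y\<close>. The
  map \<open>\<alpha> \<mapsto> rho_path \<alpha> \<xi>\<close> is nondecreasing and shortens distances strictly, because a subsolution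
  that is lowered by a constant satisfies a strict inequality and has room for a small tilt
  (\<open>subsolution_shift\<close>). Hence its fixed point \<open>beta \<xi>\<close> is unique and bounds every \<open>\<alpha>\<close> with
  \<open>\<alpha> \<le> rho_path \<alpha> \<xi>\<close>. This gives \<open>u \<le> cycle_inf\<close>, and then \<open>u \<le> vertex_value\<close> by monotonicity.
  Conversely, an arc that ends in \<open>x\<close> and satisfies the state constraint gives, by comparison,
  \<open>u x = rho (u y) e\<close> with \<open>y\<close> the origin of that arc. Following such arcs backwards one must revisit
  a vertex. The closed piece is a cycle on which \<open>u\<close> is the fixed point, so \<open>u\<close> equals \<open>cycle_inf\<close>
  at its base, and the walk, read forwards, is a path from there to \<open>x\<close> that carries this value to
  \<open>u x\<close> without loss.
\<close>

section \<open>Viscosity tests with an explicit derivative\<close>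

lemma C1_differentiable_on_UNIV_iff:
  fixes \<phi> :: "real \<Rightarrow> real"
  shows "\<phi> C1_differentiable_on UNIV \<longleftrightarrow>
    (\<exists>D. (\<forall>t. (\<phi> has_real_derivative D t) (at t)) \<and> continuous_on UNIV D)"
  by (simp add: C1_differentiable_on_def has_real_derivative_iff_has_vector_derivative)

lemma arc_subsolutionI:
  assumes "continuous_on {0..1} w"
    and "\<And>\<phi> D s d. \<lbrakk>s \<in> {0<..<1}; \<And>t. (\<phi> has_real_derivative D t) (at t);
      continuous_on UNIV D; d > 0; \<And>t. \<bar>t - s\<bar> < d \<Longrightarrow> w t - \<phi> t \<le> w s - \<phi> s\<rbrakk>
      \<Longrightarrow> lam * w s + h s (D s) \<le> 0"
  shows "arc_subsolution lam h w"
  unfolding arc_subsolution_def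
proof (intro conjI allI ballI impI)
  fix \<phi> s assume s: "s \<in> {0<..<1::real}" and "\<phi> C1_differentiable_on UNIV"
    and ev: "\<forall>\<^sub>F t in at s. w t - \<phi> t \<le> w s - \<phi> s"
  then obtain D where D: "\<And>t. (\<phi> has_real_derivative D t) (at t)" "continuous_on UNIV D"
    by (auto simp: C1_differentiable_on_UNIV_iff)
  from ev obtain d where d: "d > 0" "\<And>t. t \<noteq> s \<Longrightarrow> \<bar>t - s\<bar> < d \<Longrightarrow> w t - \<phi> t \<le> w s - \<phi> s"
    by (auto simp: eventually_at dist_real_def)
  have "w t - \<phi> t \<le> w s - \<phi> s" if "\<bar>t - s\<bar> < d" for t
    using d(2)[of t] that by (cases "t = s") auto
  from assms(2)[OF s D d(1) this] show "lam * w s + h s (deriv \<phi> s) \<le> 0"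
    using DERIV_imp_deriv[OF D(1)] by simp
qed fact

lemma arc_supersolutionI:
  assumes "continuous_on {0..1} w"
    and "\<And>\<phi> D s d. \<lbrakk>s \<in> {0<..<1}; \<And>t. (\<phi> has_real_derivative D t) (at t);
      continuous_on UNIV D; d > 0; \<And>t. \<bar>t - s\<bar> < d \<Longrightarrow> w s - \<phi> s \<le> w t - \<phi> t\<rbrakk>
      \<Longrightarrow> lam * w s + h s (D s) \<ge> 0"
  shows "arc_supersolution lam h w"
  unfolding arc_supersolution_def
proof (intro conjI allI ballI impI)
  fix \<phi> s assume s: "s \<in> {0<..<1::real}" and "\<phi> C1_differentiable_on UNIV"
    and ev: "\<forall>\<^sub>F t in at s. w t - \<phi> t \<ge> w s - \<phi> s"
  then obtain D where D: "\<And>t. (\<phi> has_real_derivative D t) (at t)" "continuous_on UNIV D"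
    by (auto simp: C1_differentiable_on_UNIV_iff)
  from ev obtain d where d: "d > 0" "\<And>t. t \<noteq> s \<Longrightarrow> \<bar>t - s\<bar> < d \<Longrightarrow> w t - \<phi> t \<ge> w s - \<phi> s"
    by (auto simp: eventually_at dist_real_def)
  have "w t - \<phi> t \<ge> w s - \<phi> s" if "\<bar>t - s\<bar> < d" for t
    using d(2)[of t] that by (cases "t = s") auto
  from assms(2)[OF s D d(1) this] show "lam * w s + h s (deriv \<phi> s) \<ge> 0"
    using DERIV_imp_deriv[OF D(1)] by simp
qed fact

lemma arc_subsolution_continuous: "arc_subsolution lam h w \<Longrightarrow> continuous_on {0..1} w"
  and arc_supersolution_continuous: "arc_supersolution lam h w \<Longrightarrow> continuous_on {0..1} w"
  by (auto simp: arc_subsolution_def arc_supersolution_def)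

lemma eventually_at_interval:
  fixes s :: real
  assumes "s \<in> {a<..<b}" "\<And>t. t \<in> {a..b} \<Longrightarrow> P t"
  shows "\<forall>\<^sub>F t in at s. P t"
  using eventually_at_in_open[of "{a<..<b}" s] assms by (auto elim!: eventually_mono)

lemma arc_subsolutionD:
  assumes "arc_subsolution lam h w" "s \<in> {0<..<1}"
    and D: "\<And>t. (\<phi> has_real_derivative D t) (at t)" "continuous_on UNIV D"
    and "s \<in> {a<..<b}" "\<And>t. t \<in> {a..b} \<Longrightarrow> w t - \<phi> t \<le> w s - \<phi> s"
  shows "lam * w s + h s (D s) \<le> 0"
proof -
  have "\<forall>\<^sub>F t in at s. w t - \<phi> t \<le> w s - \<phi> s"
    using assms(5,6) by (rule eventually_at_interval)
  moreover have "\<phi> C1_differentiable_on UNIV"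
    using D by (auto simp: C1_differentiable_on_UNIV_iff)
  ultimately show ?thesis
    using assms(1,2) DERIV_imp_deriv[OF D(1)] by (force simp: arc_subsolution_def)
qed

lemma arc_supersolutionD:
  assumes "arc_supersolution lam h w" "s \<in> {0<..<1}"
    and D: "\<And>t. (\<phi> has_real_derivative D t) (at t)" "continuous_on UNIV D"
    and "s \<in> {a<..<b}" "\<And>t. t \<in> {a..b} \<Longrightarrow> w s - \<phi> s \<le> w t - \<phi> t"
  shows "lam * w s + h s (D s) \<ge> 0"
proof -
  have "\<forall>\<^sub>F t in at s. w t - \<phi> t \<ge> w s - \<phi> s"
    using assms(5,6) by (rule eventually_at_interval)
  moreover have "\<phi> C1_differentiable_on UNIV"
    using D by (auto simp: C1_differentiable_on_UNIV_iff)
  ultimately show ?thesis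
    using assms(1,2) DERIV_imp_deriv[OF D(1)] by (force simp: arc_supersolution_def)
qed

lemma arc_subsolution_cong:
  assumes "\<And>s. s \<in> {0..1} \<Longrightarrow> w s = w' s" "\<And>s p. s \<in> {0..1} \<Longrightarrow> h s p = h' s p"
    and w: "arc_subsolution lam h w"
  shows "arc_subsolution lam h' w'"
proof (rule arc_subsolutionI)
  show "continuous_on {0..1} w'"
    using arc_subsolution_continuous[OF w] assms(1) by (rule continuous_on_eq)
next
  fix \<phi> D :: "real \<Rightarrow> real" and s d :: real
  assume s: "s \<in> {0<..<1}" and D: "\<And>t. (\<phi> has_real_derivative D t) (at t)" "continuous_on UNIV D"
    and d: "d > 0" "\<And>t. \<bar>t - s\<bar> < d \<Longrightarrow> w' t - \<phi> t \<le> w' s - \<phi> s"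
  have "w t - \<phi> t \<le> w s - \<phi> s" if "t \<in> {max 0 (s - d/2)..min 1 (s + d/2)}" for t
    using d(2)[of t] d(1) that s assms(1)[of t] assms(1)[of s] by auto
  then have "lam * w s + h s (D s) \<le> 0"
    using s d(1)
    by (intro arc_subsolutionD[OF w s D, where a="max 0 (s - d/2)" and b="min 1 (s + d/2)"]) auto
  then show "lam * w' s + h' s (D s) \<le> 0"
    using assms s by auto
qed

lemma arc_supersolution_cong:
  assumes "\<And>s. s \<in> {0..1} \<Longrightarrow> w s = w' s" and w: "arc_supersolution lam h w"
  shows "arc_supersolution lam h w'"
proof (rule arc_supersolutionI)
  show "continuous_on {0..1} w'"
    using arc_supersolution_continuous[OF w] assms(1) by (rule continuous_on_eq)
next
  fix \<phi> D :: "real \<Rightarrow> real" and s d :: real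
  assume s: "s \<in> {0<..<1}" and D: "\<And>t. (\<phi> has_real_derivative D t) (at t)" "continuous_on UNIV D"
    and d: "d > 0" "\<And>t. \<bar>t - s\<bar> < d \<Longrightarrow> w' s - \<phi> s \<le> w' t - \<phi> t"
  have "w s - \<phi> s \<le> w t - \<phi> t" if "t \<in> {max 0 (s - d/2)..min 1 (s + d/2)}" for t
    using d(2)[of t] d(1) that s assms(1)[of t] assms(1)[of s] by auto
  then have "lam * w s + h s (D s) \<ge> 0"
    using s d(1)
    by (intro arc_supersolutionD[OF w s D, where a="max 0 (s - d/2)" and b="min 1 (s + d/2)"]) auto
  then show "lam * w' s + h s (D s) \<ge> 0"
    using assms(1)[of s] s by auto
qed

lemma state_constraint_at_1_cong:
  assumes eq: "\<And>s. s \<in> {0..1} \<Longrightarrow> w s = w' s" and w: "state_constraint_at_1 lam h w"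
  shows "state_constraint_at_1 lam h w'"
  unfolding state_constraint_at_1_def
proof (intro allI impI)
  fix \<phi> assume \<phi>: "\<phi> C1_differentiable_on UNIV" "\<phi> 1 = w' 1"
    and "\<exists>\<delta>>0. \<forall>t\<in>{1 - \<delta><..<1}. w' t \<ge> \<phi> t"
  then obtain \<delta> where \<delta>: "\<delta> > 0" "\<And>t. t \<in> {1 - \<delta><..<1} \<Longrightarrow> w' t \<ge> \<phi> t" by blast
  have "w t \<ge> \<phi> t" if "t \<in> {1 - min \<delta> 1<..<1}" for t
    using \<delta>(2)[of t] eq[of t] that by auto
  then have "\<exists>\<delta>>0. \<forall>t\<in>{1 - \<delta><..<1}. w t \<ge> \<phi> t"
    using \<delta>(1) by (intro exI[of _ "min \<delta> 1"]) auto
  then show "lam * \<phi> 1 + h 1 (deriv \<phi> 1) \<ge> 0"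
    using w \<phi> eq[of 1] by (simp add: state_constraint_at_1_def)
qed

lemma arc_subsolution_reverse:
  assumes w: "arc_subsolution lam h w"
  shows "arc_subsolution lam (\<lambda>s p. h (1 - s) (- p)) (\<lambda>s. w (1 - s))"
proof (rule arc_subsolutionI)
  show "continuous_on {0..1} (\<lambda>s. w (1 - s))"
    by (rule continuous_on_compose2[OF arc_subsolution_continuous[OF w]])
       (auto intro!: continuous_intros)
next
  fix \<phi> D :: "real \<Rightarrow> real" and s d :: real
  assume s: "s \<in> {0<..<1}" and D: "\<And>t. (\<phi> has_real_derivative D t) (at t)" "continuous_on UNIV D"
    and d: "d > 0" "\<And>t. \<bar>t - s\<bar> < d \<Longrightarrow> w (1 - t) - \<phi> t \<le> w (1 - s) - \<phi> s"
  have D': "((\<lambda>t. \<phi> (1 - t)) has_real_derivative (\<lambda>t. - D (1 - t)) t) (at t)" for t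
    using DERIV_chain2[OF D(1) DERIV_diff[OF DERIV_const DERIV_ident], of 1 t UNIV] by simp
  have "continuous_on UNIV (\<lambda>t. - D (1 - t))"
    by (intro continuous_intros continuous_on_compose2[OF D(2)]) auto
  note D' = D' this
  have "w t - \<phi> (1 - t) \<le> w (1 - s) - \<phi> (1 - (1 - s))" if "t \<in> {1 - s - d/2..1 - s + d/2}" for t
    using d(2)[of "1 - t"] d(1) that by auto
  then have "lam * w (1 - s) + h (1 - s) (- D (1 - (1 - s))) \<le> 0"
    using s d(1)
    by (intro arc_subsolutionD[OF w _ D', where a="1 - s - d/2" and b="1 - s + d/2"]) auto
  then show "lam * w (1 - s) + h (1 - s) (- D s) \<le> 0" by simp
qed

text \<open>
  A test function that touches the maximum from above also touches whichever of the two functions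
  attains the maximum at that point.
\<close>

lemma arc_subsolution_max:
  assumes w: "arc_subsolution lam h w" and v: "arc_subsolution lam h v"
  shows "arc_subsolution lam h (\<lambda>s. max (w s) (v s))"
proof (rule arc_subsolutionI)
  show "continuous_on {0..1} (\<lambda>s. max (w s) (v s))"
    using w v by (intro continuous_intros) (auto intro: arc_subsolution_continuous)
next
  fix \<phi> D :: "real \<Rightarrow> real" and s d :: real
  assume s: "s \<in> {0<..<1}" and D: "\<And>t. (\<phi> has_real_derivative D t) (at t)" "continuous_on UNIV D"
    and d: "d > 0" "\<And>t. \<bar>t - s\<bar> < d \<Longrightarrow> max (w t) (v t) - \<phi> t \<le> max (w s) (v s) - \<phi> s"
  show "lam * max (w s) (v s) + h s (D s) \<le> 0"
  proof (cases "v s \<le> w s")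
    case True
    have "w t - \<phi> t \<le> w s - \<phi> s" if "t \<in> {s - d/2..s + d/2}" for t
    proof -
      have "\<bar>t - s\<bar> < d" using that d(1) by auto
      from d(2)[OF this] show ?thesis using True by simp
    qed
    then have "lam * w s + h s (D s) \<le> 0"
      using d(1) by (intro arc_subsolutionD[OF w s D, where a="s - d/2" and b="s + d/2"]) auto
    then show ?thesis using True by (simp add: max_def)
  next
    case False
    have "v t - \<phi> t \<le> v s - \<phi> s" if "t \<in> {s - d/2..s + d/2}" for t
    proof -
      have "\<bar>t - s\<bar> < d" using that d(1) by auto
      from d(2)[OF this] show ?thesis using False by simp
    qed
    then have "lam * v s + h s (D s) \<le> 0"
      using d(1) by (intro arc_subsolutionD[OF v s D, where a="s - d/2" and b="s + d/2"]) auto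
    then show ?thesis using False by (simp add: max_def)
  qed
qed

section \<open>Coercive Hamiltonians on an arc\<close>

locale discounted_arc =
  fixes lam :: real and h :: "real \<Rightarrow> real \<Rightarrow> real"
  assumes lam_pos: "lam > 0"
    and h_continuous: "continuous_on ({0..1} \<times> UNIV) (\<lambda>(s, p). h s p)"
    and h_coercive: "\<And>C. \<forall>\<^sub>F p in at_infinity. \<forall>s\<in>{0..1}. h s p \<ge> C"
begin

lemma h_compose_continuous:
  assumes "continuous_on S f" "continuous_on S g" "f ` S \<subseteq> {0..1}"
  shows "continuous_on S (\<lambda>x. h (f x) (g x))"
proof -
  have "continuous_on S (\<lambda>x. (\<lambda>(s, p). h s p) (f x, g x))"
    by (rule continuous_on_compose2[OF h_continuous]) (use assms in \<open>auto intro!: continuous_intros\<close>)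
  then show ?thesis by simp
qed

text \<open>
  Coercivity enters the proofs in this form and through the two consequences below: slopes
  are bounded where the Hamiltonian is bounded above, and the Hamiltonian is bounded below.
\<close>

lemma coercive_outside_interval:
  obtains b where "\<And>p s. b \<le> \<bar>p\<bar> \<Longrightarrow> s \<in> {0..1} \<Longrightarrow> C \<le> h s p"
  using h_coercive[of C] unfolding eventually_at_infinity real_norm_def by blast

lemma slope_bound:
  obtains R where "R > 0" "\<And>s p. s \<in> {0..1} \<Longrightarrow> h s p \<le> C \<Longrightarrow> \<bar>p\<bar> \<le> R"
proof -
  obtain b where b: "\<And>p s. b \<le> \<bar>p\<bar> \<Longrightarrow> s \<in> {0..1} \<Longrightarrow> h s p \<ge> C + 1"
    using coercive_outside_interval by blast
  have "\<bar>p\<bar> \<le> max 1 b" if "s \<in> {0..1}" "h s p \<le> C" for s p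
    using b[of p s] that by linarith
  then show ?thesis by (intro that[of "max 1 b"]) auto
qed

lemma h_uniformly_continuous:
  assumes "e > 0"
  obtains d where "d > 0"
    "\<And>s t p q. \<lbrakk>s \<in> {0..1}; t \<in> {0..1}; \<bar>p\<bar> \<le> R; \<bar>q\<bar> \<le> R; \<bar>s - t\<bar> < d; \<bar>p - q\<bar> < d\<rbrakk>
      \<Longrightarrow> \<bar>h s p - h t q\<bar> < e"
proof -
  have "uniformly_continuous_on ({0..1} \<times> {-R..R}) (\<lambda>(s, p). h s p)"
    by (intro compact_uniformly_continuous compact_Times compact_Icc
        continuous_on_subset[OF h_continuous]) auto
  then obtain d where d: "d > 0" "\<And>x y. x \<in> {0..1} \<times> {-R..R} \<Longrightarrow> y \<in> {0..1} \<times> {-R..R} \<Longrightarrow>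
      dist y x < d \<Longrightarrow> dist (case_prod h y) (case_prod h x) < e"
    by (rule uniformly_continuous_onE[OF _ assms]) blast
  show ?thesis
  proof (rule that[of "d / 2"])
    fix s t p q :: real
    assume *: "s \<in> {0..1}" "t \<in> {0..1}" "\<bar>p\<bar> \<le> R" "\<bar>q\<bar> \<le> R" "\<bar>s - t\<bar> < d/2" "\<bar>p - q\<bar> < d/2"
    have "dist (s, p) (t, q) \<le> \<bar>s - t\<bar> + \<bar>p - q\<bar>"
      unfolding dist_Pair_Pair fst_conv snd_conv dist_real_def power2_abs
      by (rule sqrt_sum_squares_le_sum_abs)
    then show "\<bar>h s p - h t q\<bar> < e"
      using d(2)[of "(t, q)" "(s, p)"] * by (auto simp: dist_real_def abs_le_iff)
  qed (use d in simp)
qed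

lemma h_lower_bound:
  obtains m where "\<And>s p. s \<in> {0..1} \<Longrightarrow> m \<le> h s p"
proof -
  obtain R where R: "R > 0" "\<And>s p. s \<in> {0..1} \<Longrightarrow> h s p \<le> 0 \<Longrightarrow> \<bar>p\<bar> \<le> R"
    using slope_bound[of 0] by blast
  have "\<exists>z\<in>{0..1} \<times> {-R..R}. \<forall>x\<in>{0..1} \<times> {-R..R}. case_prod h z \<le> case_prod h x"
    by (rule continuous_attains_inf)
       (use R(1) in \<open>auto intro: compact_Times continuous_on_subset[OF h_continuous]\<close>)
  then obtain z where z: "\<And>x. x \<in> {0..1} \<times> {-R..R} \<Longrightarrow> case_prod h z \<le> case_prod h x"
    by blast
  have "min 0 (case_prod h z) \<le> h s p" if "s \<in> {0..1}" for s p
  proof (cases "h s p \<le> 0")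
    case True
    then show ?thesis using R(2)[OF that True] z[of "(s, p)"] that by (auto simp: abs_le_iff)
  qed auto
  then show ?thesis using that by blast
qed

lemma constant_subsolution_bound:
  obtains K where "\<And>c. c \<le> K \<Longrightarrow> arc_subsolution lam h (\<lambda>_. c)"
proof -
  have "continuous_on {0..1} (\<lambda>s. h s 0)"
    by (rule h_compose_continuous) (auto intro!: continuous_intros)
  then obtain z where z: "\<And>s. s \<in> {0..1} \<Longrightarrow> h s 0 \<le> h z 0"
    using continuous_attains_sup[of "{0..1::real}" "\<lambda>s. h s 0"] by fastforce
  show ?thesis
  proof (rule that[of "- h z 0 / lam"], rule arc_subsolutionI)
    fix c \<phi> D s d
    assume c: "c \<le> - h z 0 / lam" and s: "s \<in> {0<..<1}"
      and D: "\<And>t. (\<phi> has_real_derivative D t) (at t)"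
      and d: "d > 0" "\<And>t. \<bar>t - s\<bar> < d \<Longrightarrow> c - \<phi> t \<le> c - \<phi> s"
    have "D s = 0"
      using d by (intro DERIV_local_min[OF D d(1)]) (auto simp: abs_minus_commute)
    moreover have "lam * c \<le> - h z 0"
      using c lam_pos by (simp add: field_simps)
    ultimately show "lam * c + h s (D s) \<le> 0"
      using z[of s] s by auto
  qed simp
qed

end

section \<open>A priori bounds for subsolutions\<close>

text \<open>
  If some secant slope over \<open>[a, b]\<close> exceeded \<open>R\<close>, add to the line of slope \<open>R\<close> a convex exponential that
  is small up to \<open>b\<close> and very steep beyond. Up to a constant the sum touches \<open>w\<close> from above at a point
  strictly between \<open>a\<close> and \<open>1\<close>, with a slope larger than \<open>R\<close>. The room to the right of \<open>b\<close> is essential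
  here, so \<open>b = 1\<close> is reached by continuity.
\<close>

lemma slope_bound_from_test_functions:
  fixes w :: "real \<Rightarrow> real"
  assumes cont: "continuous_on {0..1} w"
    and test: "\<And>\<phi> D s a b. \<lbrakk>s \<in> {0<..<1}; \<And>t. (\<phi> has_real_derivative D t) (at t);
      continuous_on UNIV D; s \<in> {a<..<b}; \<And>t. t \<in> {a..b} \<Longrightarrow> w t - \<phi> t \<le> w s - \<phi> s\<rbrakk>
      \<Longrightarrow> D s \<le> R"
    and ab: "0 \<le> a" "a < b" "b \<le> 1"
  shows "w b - w a \<le> R * (b - a)"
proof -
  have interior: "w b - w a \<le> R * (b - a)" if b: "a < b" "b < 1" for b
  proof (rule ccontr)
    assume *: "\<not> w b - w a \<le> R * (b - a)"
    define \<eta> where "\<eta> = ((w b - w a) - R * (b - a)) / 2"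
    \<comment> \<open>With this \<open>K\<close> the inequality \<open>exp x \<ge> 1 + x\<close> makes \<open>w - \<phi>\<close> smaller at \<open>1\<close> than at \<open>b\<close>.\<close>
    define K where "K = (\<bar>w 1 - R - (w b - R * b)\<bar> + \<eta> + 1) / (\<eta> * (1 - b))"
    define \<phi> where "\<phi> = (\<lambda>t. R * t + \<eta> * exp (K * (t - b)))"
    have \<eta>: "\<eta> > 0" using * by (simp add: \<eta>_def)
    have K: "K > 0" unfolding K_def using \<eta> b by (intro divide_pos_pos) auto
    have "continuous_on {a..1} (\<lambda>t. w t - \<phi> t)"
      unfolding \<phi>_def using ab b
      by (intro continuous_intros continuous_on_subset[OF cont]) auto
    then obtain c where c: "c \<in> {a..1}" "\<And>t. t \<in> {a..1} \<Longrightarrow> w t - \<phi> t \<le> w c - \<phi> c"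
      using continuous_attains_sup[of "{a..1}" "\<lambda>t. w t - \<phi> t"] b by fastforce
    have at_b: "w b - \<phi> b = w b - R * b - \<eta>" by (simp add: \<phi>_def)
    have "w a - \<phi> a < w a - R * a" using \<eta> by (simp add: \<phi>_def)
    also have "\<dots> = w b - R * b - 2 * \<eta>" unfolding \<eta>_def by (simp add: field_simps)
    also have "\<dots> < w b - \<phi> b" using \<eta> unfolding at_b by simp
    finally have "c \<noteq> a" using c(2)[of b] b by auto
    define v where "v = w 1 - R - (w b - R * b)"
    define x where "x = \<eta> * exp (K * (1 - b))"
    have "\<eta> * (1 + K * (1 - b)) \<le> x"
      unfolding x_def using \<eta> by (intro mult_left_mono exp_ge_add_one_self) auto
    moreover have "\<eta> * (1 + K * (1 - b)) = \<bar>v\<bar> + 2 * \<eta> + 1"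
    proof -
      have "K * (\<eta> * (1 - b)) = \<bar>v\<bar> + \<eta> + 1"
        using \<eta> b by (simp add: K_def flip: v_def)
      then show ?thesis by (simp add: algebra_simps)
    qed
    ultimately have "v < x - \<eta>" using \<eta> by linarith
    moreover have "w 1 - \<phi> 1 = w 1 - R - x" by (simp add: \<phi>_def x_def)
    ultimately have "w 1 - \<phi> 1 < w b - \<phi> b"
      unfolding at_b v_def by linarith
    then have "c \<noteq> 1" using c(2)[of b] b by auto
    with \<open>c \<noteq> a\<close> c(1) have ac: "c \<in> {a<..<1}" by auto
    have "R + \<eta> * K * exp (K * (c - b)) \<le> R"
    proof (rule test[where \<phi>=\<phi> and D="\<lambda>t. R + \<eta> * K * exp (K * (t - b))", OF _ _ _ ac c(2)])
      show "c \<in> {0<..<1}" using ac ab by auto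
      show "(\<phi> has_real_derivative R + \<eta> * K * exp (K * (t - b))) (at t)" for t
        unfolding \<phi>_def by (auto intro!: derivative_eq_intros)
      show "continuous_on UNIV (\<lambda>t. R + \<eta> * K * exp (K * (t - b)))"
        by (intro continuous_intros)
    qed
    moreover have "\<eta> * K * exp (K * (c - b)) > 0" using \<eta> K by simp
    ultimately show False by linarith
  qed
  have "closure {a<..<1} = {a..1}" using ab by (intro closure_greaterThanLessThan) auto
  moreover have "continuous_on {a..1} (\<lambda>t. w t - R * t)"
    using ab by (intro continuous_intros continuous_on_subset[OF cont]) auto
  moreover have "w t - R * t \<le> w a - R * a" if "t \<in> {a<..<1}" for t
    using interior[of t] that by (simp add: algebra_simps)
  ultimately have "w b - R * b \<le> w a - R * a"
    using continuous_le_on_closure[of "{a<..<1}" "\<lambda>t. w t - R * t" b] ab by auto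
  then show ?thesis by (simp add: algebra_simps)
qed

context discounted_arc
begin

lemma discounted_arc_reverse: "discounted_arc lam (\<lambda>s p. h (1 - s) (- p))"
proof
  have "continuous_on ({0..1} \<times> UNIV) (\<lambda>x. h (1 - fst x) (- snd x))"
    by (rule h_compose_continuous) (auto intro!: continuous_intros)
  then show "continuous_on ({0..1} \<times> UNIV) (\<lambda>(s, p). h (1 - s) (- p))"
    by (simp add: case_prod_unfold)
  fix C
  obtain b where "\<And>p s. b \<le> \<bar>p\<bar> \<Longrightarrow> s \<in> {0..1} \<Longrightarrow> h s p \<ge> C"
    using coercive_outside_interval by blast
  then show "\<forall>\<^sub>F p in at_infinity. \<forall>s\<in>{0..1}. C \<le> h (1 - s) (- p)"
    unfolding eventually_at_infinity by (intro exI[of _ b]) auto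
qed (rule lam_pos)

lemma subsolution_test_slope:
  assumes "arc_subsolution lam h w" "s \<in> {0<..<1}"
    and "\<And>t. (\<phi> has_real_derivative D t) (at t)" "continuous_on UNIV D"
    and "s \<in> {a<..<b}" "\<And>t. t \<in> {a..b} \<Longrightarrow> w t - \<phi> t \<le> w s - \<phi> s"
    and "- M \<le> w s"
  shows "h s (D s) \<le> lam * M"
proof -
  have "lam * - M \<le> lam * w s" using assms(7) lam_pos by (intro mult_left_mono) auto
  then show ?thesis using arc_subsolutionD[OF assms(1-6)] by simp
qed

text \<open>
  The Lipschitz constant depends on a subsolution only through a lower bound: where \<open>w \<ge> - M\<close> the
  equation gives \<open>h s p \<le> lam * M\<close> for every slope \<open>p\<close> of a test function. So families of subsolutions
  with a common lower bound are equi-Lipschitz. Decrease is controlled by running along the arc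
  backwards.
\<close>

lemma subsolution_Lipschitz:
  obtains R where "R > 0"
    "\<And>w a b. \<lbrakk>arc_subsolution lam h w; \<And>s. s \<in> {0..1} \<Longrightarrow> - M \<le> w s; a \<in> {0..1}; b \<in> {0..1}\<rbrakk>
      \<Longrightarrow> \<bar>w a - w b\<bar> \<le> R * \<bar>a - b\<bar>"
proof -
  obtain R where R: "R > 0" "\<And>s p. s \<in> {0..1} \<Longrightarrow> h s p \<le> lam * M \<Longrightarrow> \<bar>p\<bar> \<le> R"
    using slope_bound by blast
  have *: "\<bar>w a - w b\<bar> \<le> R * \<bar>a - b\<bar>"
    if w: "arc_subsolution lam h w" and M: "\<And>s. s \<in> {0..1} \<Longrightarrow> - M \<le> w s"
      and ab: "a \<in> {0..1}" "b \<in> {0..1}" "a < b" for w a b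
  proof -
    have "w b - w a \<le> R * (b - a)"
    proof (rule slope_bound_from_test_functions)
      fix \<phi> D :: "real \<Rightarrow> real" and s a b :: real
      assume *: "s \<in> {0<..<1}" "\<And>t. (\<phi> has_real_derivative D t) (at t)" "continuous_on UNIV D"
        "s \<in> {a<..<b}" "\<And>t. t \<in> {a..b} \<Longrightarrow> w t - \<phi> t \<le> w s - \<phi> s"
      have "h s (D s) \<le> lam * M"
        by (rule subsolution_test_slope[OF w *]) (use M *(1) in auto)
      then show "D s \<le> R" using R(2)[of s "D s"] *(1) by auto
    qed (use ab w in \<open>auto intro: arc_subsolution_continuous\<close>)
    moreover have "w (1 - (1 - a)) - w (1 - (1 - b)) \<le> R * ((1 - a) - (1 - b))"
    proof (rule slope_bound_from_test_functions)
      interpret reverse: discounted_arc lam "\<lambda>s p. h (1 - s) (- p)"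
        by (rule discounted_arc_reverse)
      note w' = arc_subsolution_reverse[OF w]
      show "continuous_on {0..1} (\<lambda>t. w (1 - t))"
        using w' by (rule arc_subsolution_continuous)
      fix \<phi> D :: "real \<Rightarrow> real" and s a b :: real
      assume *: "s \<in> {0<..<1}" "\<And>t. (\<phi> has_real_derivative D t) (at t)" "continuous_on UNIV D"
        "s \<in> {a<..<b}" "\<And>t. t \<in> {a..b} \<Longrightarrow> w (1 - t) - \<phi> t \<le> w (1 - s) - \<phi> s"
      have "h (1 - s) (- D s) \<le> lam * M"
        by (rule reverse.subsolution_test_slope[OF w' *]) (use M *(1) in auto)
      then show "D s \<le> R" using R(2)[of "1 - s" "- D s"] *(1) by auto
    qed (use ab in auto)
    ultimately show ?thesis using ab by (simp add: abs_if algebra_simps)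
  qed
  have "\<bar>w a - w b\<bar> \<le> R * \<bar>a - b\<bar>"
    if "arc_subsolution lam h w" "\<And>s. s \<in> {0..1} \<Longrightarrow> - M \<le> w s" "a \<in> {0..1}" "b \<in> {0..1}" for w a b
    using that(1,2) that(3,4) *[OF that(1,2), of a b] *[OF that(1,2), of b a]
    by (cases a b rule: linorder_cases) (auto simp: abs_minus_commute)
  then show ?thesis using that R(1) by blast
qed

text \<open>
  A parabola that is narrow enough touches \<open>w\<close> from above at an interior point \<open>c\<close> with
  \<open>w c \<ge> w s\<close>, and at such a point the equation bounds \<open>w\<close> in terms of the infimum of the Hamiltonian.
\<close>

lemma subsolution_upper_bound:
  obtains B where "\<And>w s. arc_subsolution lam h w \<Longrightarrow> s \<in> {0..1} \<Longrightarrow> w s \<le> B"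
proof -
  obtain m where m: "\<And>s p. s \<in> {0..1} \<Longrightarrow> m \<le> h s p"
    using h_lower_bound by blast
  have interior: "w s \<le> - m / lam" if w: "arc_subsolution lam h w" and s: "s \<in> {0<..<1}" for w s
  proof -
    \<comment> \<open>Large enough for the parabola centred at \<open>s\<close> to keep the maximum away from \<open>0\<close> and \<open>1\<close>.\<close>
    define K where "K = (\<bar>w 0 - w s\<bar> + 1) / s\<^sup>2 + (\<bar>w 1 - w s\<bar> + 1) / (1 - s)\<^sup>2"
    have pos: "(\<bar>w 0 - w s\<bar> + 1) / s\<^sup>2 > 0" "(\<bar>w 1 - w s\<bar> + 1) / (1 - s)\<^sup>2 > 0"
      using s by (auto intro!: divide_pos_pos)
    have K: "K * s\<^sup>2 > w 0 - w s" "K * (1 - s)\<^sup>2 > w 1 - w s"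
    proof -
      have "(\<bar>w 0 - w s\<bar> + 1) / s\<^sup>2 * s\<^sup>2 \<le> K * s\<^sup>2"
        using pos by (intro mult_right_mono) (auto simp: K_def)
      then show "K * s\<^sup>2 > w 0 - w s" using s by simp
      have "(\<bar>w 1 - w s\<bar> + 1) / (1 - s)\<^sup>2 * (1 - s)\<^sup>2 \<le> K * (1 - s)\<^sup>2"
        using pos by (intro mult_right_mono) (auto simp: K_def)
      then show "K * (1 - s)\<^sup>2 > w 1 - w s" using s by simp
    qed
    have "continuous_on {0..1} (\<lambda>t. w t - K * (t - s)\<^sup>2)"
      by (intro continuous_intros arc_subsolution_continuous[OF w])
    then obtain c where c: "c \<in> {0..1}"
      "\<And>t. t \<in> {0..1} \<Longrightarrow> w t - K * (t - s)\<^sup>2 \<le> w c - K * (c - s)\<^sup>2"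
      using continuous_attains_sup[of "{0..1::real}" "\<lambda>t. w t - K * (t - s)\<^sup>2"] by fastforce
    have ws: "w s \<le> w c - K * (c - s)\<^sup>2" using c(2)[of s] s by simp
    have "c \<noteq> 0" using ws K(1) by auto
    moreover have "c \<noteq> 1" using ws K(2) by auto
    ultimately have c01: "c \<in> {0<..<1}" using c(1) by auto
    have "lam * w c + h c (2 * K * (c - s)) \<le> 0"
      by (rule arc_subsolutionD[OF w c01 _ _ c01 c(2)])
         (auto intro!: derivative_eq_intros continuous_intros)
    then have upper: "lam * w c \<le> - m" using m[of c "2 * K * (c - s)"] c(1) by linarith
    have "K * (c - s)\<^sup>2 \<ge> 0" using pos by (simp add: K_def)
    then have "lam * w s \<le> lam * w c"
      using ws lam_pos by (intro mult_left_mono) linarith+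
    then have "lam * w s \<le> - m" using upper by linarith
    then show ?thesis
      using lam_pos by (simp add: field_simps)
  qed
  have "w s \<le> - m / lam" if w: "arc_subsolution lam h w" and s: "s \<in> {0..1}" for w s
    using continuous_le_on_closure[of "{0<..<1}" w s "- m / lam"] interior[OF w] s
      arc_subsolution_continuous[OF w] by simp
  then show ?thesis using that by blast
qed

end

section \<open>Suprema and bumps\<close>

lemma negative_near:
  fixes G :: "real \<Rightarrow> real"
  assumes "continuous_on {0..1} G" "s \<in> {0..1}" "G s < 0"
  obtains c r where "c > 0" "r > 0" "\<And>t. t \<in> {0..1} \<Longrightarrow> \<bar>t - s\<bar> < r \<Longrightarrow> G t \<le> - c"
proof -
  obtain r where r: "r > 0" "\<And>t. t \<in> {0..1} \<Longrightarrow> dist t s < r \<Longrightarrow> dist (G t) (G s) < - G s / 2"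
    using assms unfolding continuous_on_iff
    by (metis divide_pos_pos neg_0_less_iff_less zero_less_numeral)
  show ?thesis
  proof (rule that[of "- G s / 2" r])
    show "G t \<le> - (- G s / 2)" if "t \<in> {0..1}" "\<bar>t - s\<bar> < r" for t
      using r(2)[of t] that by (auto simp: dist_real_def abs_less_iff)
  qed (use assms(3) r(1) in auto)
qed

text \<open>
  The common lower bound makes the family equi-Lipschitz, hence the supremum continuous. If \<open>\<phi>\<close> touches
  the supremum at \<open>s\<close>, then \<open>\<phi> + (t - s)\<^sup>2\<close> touches a nearly optimal member of the family at a point
  close to \<open>s\<close>, where that member is still nearly optimal.
\<close>

lemma (in discounted_arc) subsolution_Sup:
  assumes nonempty: "F \<noteq> {}" and sub: "\<And>w. w \<in> F \<Longrightarrow> arc_subsolution lam h w"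
    and lower: "\<And>w s. w \<in> F \<Longrightarrow> s \<in> {0..1} \<Longrightarrow> - M \<le> w s"
  shows "arc_subsolution lam h (\<lambda>s. SUP w\<in>F. w s)"
proof -
  define u where "u = (\<lambda>s. SUP w\<in>F. w s)"
  obtain R where R: "R > 0" "\<And>w a b. \<lbrakk>arc_subsolution lam h w;
      \<And>s. s \<in> {0..1} \<Longrightarrow> - M \<le> w s; a \<in> {0..1}; b \<in> {0..1}\<rbrakk> \<Longrightarrow> \<bar>w a - w b\<bar> \<le> R * \<bar>a - b\<bar>"
    using subsolution_Lipschitz by blast
  obtain B where B: "\<And>w s. arc_subsolution lam h w \<Longrightarrow> s \<in> {0..1} \<Longrightarrow> w s \<le> B"
    using subsolution_upper_bound by blast
  have bdd: "bdd_above ((\<lambda>w. w s) ` F)" if "s \<in> {0..1}" for s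
    using B[OF sub that] by (auto simp: bdd_above_def)
  have upper: "w s \<le> u s" if "w \<in> F" "s \<in> {0..1}" for w s
    unfolding u_def by (rule cSUP_upper[OF that(1) bdd[OF that(2)]])
  have near: "\<exists>w\<in>F. u s - e < w s" if "s \<in> {0..1}" "e > 0" for s e
    using less_cSUP_iff[OF nonempty bdd[OF that(1)], of "u s - e"] that(2) by (simp add: u_def)
  have *: "u a \<le> u b + R * \<bar>a - b\<bar>" if ab: "a \<in> {0..1}" "b \<in> {0..1}" for a b
    unfolding u_def
  proof (rule cSUP_least[OF nonempty])
    fix w assume w: "w \<in> F"
    then have "\<bar>w a - w b\<bar> \<le> R * \<bar>a - b\<bar>"
      by (intro R(2) sub lower ab)
    then show "w a \<le> (SUP w\<in>F. w b) + R * \<bar>a - b\<bar>"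
      using upper[OF w ab(2)] unfolding u_def by linarith
  qed
  have "\<bar>u a - u b\<bar> \<le> R * \<bar>a - b\<bar>" if "a \<in> {0..1}" "b \<in> {0..1}" for a b
    using *[OF that] *[OF that(2,1)] by (simp add: abs_le_iff abs_minus_commute)
  then have "R-lipschitz_on {0..1} u"
    using R(1) by (intro lipschitz_onI) (auto simp: dist_real_def)
  then have u_cont: "continuous_on {0..1} u" by (rule lipschitz_on_continuous_on)
  have "arc_subsolution lam h u"
  proof (rule arc_subsolutionI[OF u_cont])
    fix \<phi> D :: "real \<Rightarrow> real" and s d :: real
    assume s: "s \<in> {0<..<1}" and D: "\<And>t. (\<phi> has_real_derivative D t) (at t)" "continuous_on UNIV D"
      and d: "d > 0" "\<And>t. \<bar>t - s\<bar> < d \<Longrightarrow> u t - \<phi> t \<le> u s - \<phi> s"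
    have \<phi>_cont: "continuous_on S \<phi>" for S
      using DERIV_isCont[OF D(1)] by (simp add: continuous_at_imp_continuous_on)
    define G where "G t = lam * u t + h t (D t + 2 * (t - s))" for t
    have G_cont: "continuous_on {0..1} G"
      unfolding G_def
      by (intro continuous_intros u_cont h_compose_continuous continuous_on_subset[OF D(2)]) auto
    have "G s \<le> 0"
    proof (rule ccontr)
      assume "\<not> G s \<le> 0"
      then obtain c r0 where c: "c > 0" "r0 > 0" "\<And>t. t \<in> {0..1} \<Longrightarrow> \<bar>t - s\<bar> < r0 \<Longrightarrow> c \<le> G t"
        using negative_near[of "\<lambda>t. - G t" s] continuous_on_minus[OF G_cont] s by auto
      define r where "r = min (min (r0 / 2) (d / 2)) (min (s / 2) ((1 - s) / 2))"
      have r: "r > 0" "r < r0" "r < d" "r < s" "r < 1 - s" using c d s by (auto simp: r_def min_less_iff_disj)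
      define e where "e = min (r\<^sup>2 / 2) (c / (2 * lam))"
      have e: "e > 0" "e < r\<^sup>2" "lam * e < c"
        using c r(1) lam_pos by (auto simp: e_def min_def field_simps)
      obtain w where w: "w \<in> F" "u s - e < w s" using near[of s e] s e by auto
      have "continuous_on {s - r..s + r} (\<lambda>t. w t - \<phi> t - (t - s)\<^sup>2)"
        using r arc_subsolution_continuous[OF sub[OF w(1)]]
        by (intro continuous_intros \<phi>_cont) (auto elim!: continuous_on_subset)
      then obtain t where t: "t \<in> {s - r..s + r}"
        "\<And>x. x \<in> {s - r..s + r} \<Longrightarrow> w x - \<phi> x - (x - s)\<^sup>2 \<le> w t - \<phi> t - (t - s)\<^sup>2"
        using continuous_attains_sup[of "{s - r..s + r}" "\<lambda>t. w t - \<phi> t - (t - s)\<^sup>2"] r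
        by fastforce
      have t01: "t \<in> {0<..<1}" using t(1) r by auto
      have "w s - \<phi> s \<le> w t - \<phi> t - (t - s)\<^sup>2" using t(2)[of s] r by auto
      moreover have "u t - \<phi> t \<le> u s - \<phi> s" using d(2)[of t] t(1) r by (auto simp: abs_le_iff)
      moreover have "w t \<le> u t" using upper[OF w(1)] t01 by auto
      ultimately have close: "(t - s)\<^sup>2 < e" "u t - e < w t"
        using w(2) zero_le_power2[of "t - s"] by linarith+
      have "(t - s)\<^sup>2 < r\<^sup>2" using close(1) e(2) by linarith
      then have tr: "\<bar>t - s\<bar> < r" using r(1) power2_less_imp_less[of "\<bar>t - s\<bar>" r] by simp
      have "lam * w t + h t (D t + 2 * (t - s)) \<le> 0"
      proof (rule arc_subsolutionD[OF sub[OF w(1)] t01])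
        show "((\<lambda>x. \<phi> x + (x - s)\<^sup>2) has_real_derivative D x + 2 * (x - s)) (at x)" for x
          by (auto intro!: derivative_eq_intros D(1))
        show "continuous_on UNIV (\<lambda>x. D x + 2 * (x - s))"
          by (intro continuous_intros D(2))
        show "t \<in> {s - r<..<s + r}" using tr by (auto simp: abs_less_iff)
      qed (use t(2) in force)
      moreover have "lam * (u t - e) \<le> lam * w t"
        using close(2) lam_pos by (intro mult_left_mono) auto
      ultimately have "G t \<le> lam * e" by (simp add: G_def algebra_simps)
      moreover have "c \<le> G t" using c(3)[of t] t01 tr r by auto
      ultimately show False using e(3) by linarith
    qed
    then show "lam * u s + h s (D s) \<le> 0" by (simp add: G_def)
  qed
  then show ?thesis by (simp add: u_def)
qed

text \<open>
  Pasting \<open>z\<close> on top of a subsolution: the inequality for \<open>z\<close> is required only on \<open>C\<close>, the only place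
  where \<open>z\<close> can exceed \<open>w\<close>. The gap between \<open>C\<close> and the complement of the open set \<open>U\<close> makes the
  pasted function continuous.
\<close>

lemma arc_subsolution_bump:
  assumes w: "arc_subsolution lam h w" and "open U" "closed C" "C \<subseteq> U"
    and z: "\<And>t. (z has_real_derivative Dz t) (at t)"
    and below: "\<And>t. t \<in> U - C \<Longrightarrow> t \<in> {0..1} \<Longrightarrow> z t \<le> w t"
    and strict: "\<And>t. t \<in> C \<Longrightarrow> t \<in> {0<..<1} \<Longrightarrow> lam * z t + h t (Dz t) \<le> 0"
  shows "arc_subsolution lam h (\<lambda>t. if t \<in> U then max (w t) (z t) else w t)"
    (is "arc_subsolution lam h ?v")
proof (rule arc_subsolutionI)
  have w_cont: "continuous_on {0..1} w" using w by (rule arc_subsolution_continuous)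
  have max_cont: "continuous_on {0..1} (\<lambda>t. max (w t) (z t))"
    using DERIV_isCont[OF z] by (intro continuous_intros w_cont continuous_at_imp_continuous_on) auto
  show "continuous_on {0..1} ?v"
    unfolding continuous_on_eq_continuous_within
  proof
    fix t :: real assume t: "t \<in> {0..1}"
    show "continuous (at t within {0..1}) ?v"
    proof (cases "t \<in> U")
      case True
      show ?thesis
        by (rule continuous_transform_within_openin[where f="\<lambda>t. max (w t) (z t)" and S="{0..1} \<inter> U"])
           (use True t max_cont \<open>open U\<close> in \<open>auto simp: continuous_on_eq_continuous_within\<close>)
    next
      case False
      show ?thesis
        by (rule continuous_transform_within_openin[where f=w and S="{0..1} \<inter> - C"])
           (use False t w_cont \<open>closed C\<close> \<open>C \<subseteq> U\<close> below in
             \<open>auto simp: continuous_on_eq_continuous_within openin_open_Int open_Compl max_absorb1\<close>)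
    qed
  qed
  fix \<phi> D :: "real \<Rightarrow> real" and s d :: real
  assume s: "s \<in> {0<..<1}" and D: "\<And>t. (\<phi> has_real_derivative D t) (at t)" "continuous_on UNIV D"
    and d: "d > 0" "\<And>t. \<bar>t - s\<bar> < d \<Longrightarrow> ?v t - \<phi> t \<le> ?v s - \<phi> s"
  show "lam * ?v s + h s (D s) \<le> 0"
  proof (cases "?v s = w s")
    case True
    have "w t - \<phi> t \<le> w s - \<phi> s" if "t \<in> {s - d/2..s + d/2}" for t
    proof -
      have "\<bar>t - s\<bar> < d" using that d(1) by auto
      moreover have "w t \<le> ?v t" by simp
      ultimately show ?thesis using d(2)[of t] unfolding True by linarith
    qed
    then have "lam * w s + h s (D s) \<le> 0"
      using d(1) by (intro arc_subsolutionD[OF w s D, where a="s - d/2" and b="s + d/2"]) auto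
    then show ?thesis unfolding True .
  next
    case False
    then have sU: "s \<in> U" and vs: "?v s = z s" and "\<not> z s \<le> w s"
      by (auto simp: max_def split: if_splits)
    then have "s \<in> C" using below[of s] s by auto
    obtain e where e: "e > 0" "\<And>t. \<bar>s - t\<bar> < e \<Longrightarrow> t \<in> U"
      using \<open>open U\<close> sU by (fastforce simp: open_contains_ball subset_eq dist_real_def)
    have "Dz s - D s = 0"
    proof (rule DERIV_local_max[where f="\<lambda>t. z t - \<phi> t" and x=s and d="min d e"])
      show "\<forall>t. \<bar>s - t\<bar> < min d e \<longrightarrow> z t - \<phi> t \<le> z s - \<phi> s"
      proof (intro allI impI)
        fix t assume t: "\<bar>s - t\<bar> < min d e"
        then have "z t \<le> ?v t" using e(2)[of t] by simp
        then show "z t - \<phi> t \<le> z s - \<phi> s"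
          using d(2)[of t] t unfolding vs by (simp add: abs_minus_commute)
      qed
    qed (use d(1) e(1) in \<open>auto intro!: derivative_intros z D(1)\<close>)
    then show ?thesis using strict[OF \<open>s \<in> C\<close> s] unfolding vs by simp
  qed
qed

context discounted_arc
begin

text \<open>
  Near a point at which the supersolution inequality fails strictly, the test function is a strict
  subsolution that lies below \<open>w\<close>. Lowered by a parabola and lifted by no more than that parabola drops
  within distance \<open>r/2\<close>, it exceeds \<open>w\<close> only close to \<open>s\<close>.
\<close>

lemma interior_bump:
  assumes w: "arc_subsolution lam h w" and "\<not> arc_supersolution lam h w"
  obtains v s where "arc_subsolution lam h v" "\<And>t. w t \<le> v t" "v 0 = w 0" "v 1 = w 1"
    "s \<in> {0<..<1}" "w s < v s"
proof -
  have w_cont: "continuous_on {0..1} w" using w by (rule arc_subsolution_continuous)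
  have "\<exists>\<phi> D s d. s \<in> {0<..<1} \<and> (\<forall>t. (\<phi> has_real_derivative D t) (at t)) \<and> continuous_on UNIV D \<and>
      d > 0 \<and> (\<forall>t. \<bar>t - s\<bar> < d \<longrightarrow> w s - \<phi> s \<le> w t - \<phi> t) \<and> \<not> lam * w s + h s (D s) \<ge> 0"
  proof (rule ccontr)
    assume *: "\<not> ?thesis"
    have "arc_supersolution lam h w"
      by (rule arc_supersolutionI[OF w_cont]) (use * in blast)
    with assms(2) show False by contradiction
  qed
  then obtain \<phi> D s d where s: "s \<in> {0<..<1}"
    and D: "\<And>t. (\<phi> has_real_derivative D t) (at t)" "continuous_on UNIV D"
    and d: "d > 0" "\<And>t. \<bar>t - s\<bar> < d \<Longrightarrow> w s - \<phi> s \<le> w t - \<phi> t"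
    and neg: "lam * w s + h s (D s) < 0"
    by (auto simp: not_le)
  have \<phi>_cont: "continuous_on S \<phi>" for S
    using DERIV_isCont[OF D(1)] by (simp add: continuous_at_imp_continuous_on)
  define \<psi> where "\<psi> t = \<phi> t + (w s - \<phi> s)" for t
  define G where "G t = lam * \<psi> t + h t (D t - 2 * (t - s))" for t
  have "continuous_on {0..1} G"
    unfolding G_def \<psi>_def
    by (intro continuous_intros \<phi>_cont h_compose_continuous continuous_on_subset[OF D(2)]) auto
  moreover have "G s < 0" using neg by (simp add: G_def \<psi>_def)
  ultimately obtain c r0 where c: "c > 0" "r0 > 0"
      "\<And>t. t \<in> {0..1} \<Longrightarrow> \<bar>t - s\<bar> < r0 \<Longrightarrow> G t \<le> - c"
    using negative_near[of G s] s by auto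
  define r where "r = min (min r0 d) (min s (1 - s))"
  have r: "r > 0" "r \<le> r0" "r \<le> d" "r \<le> s" "r \<le> 1 - s" using c d s by (auto simp: r_def)
  define \<eta> where "\<eta> = min ((r/2)\<^sup>2) (c / lam)"
  have \<eta>: "\<eta> > 0" "\<eta> \<le> (r/2)\<^sup>2" "lam * \<eta> \<le> c"
    using c r(1) lam_pos by (auto simp: \<eta>_def min_def field_simps)
  define z where "z t = \<psi> t - (t - s)\<^sup>2 + \<eta>" for t
  let ?v = "\<lambda>t. if t \<in> ball s r then max (w t) (z t) else w t"
  have "arc_subsolution lam h ?v"
  proof (rule arc_subsolution_bump[OF w, where C="cball s (r/2)" and Dz="\<lambda>t. D t - 2 * (t - s)"])
    show "(z has_real_derivative D t - 2 * (t - s)) (at t)" for t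
      unfolding z_def \<psi>_def by (auto intro!: derivative_eq_intros D(1))
    show "z t \<le> w t" if t: "t \<in> ball s r - cball s (r/2)" for t
    proof -
      have *: "r/2 < \<bar>t - s\<bar>" "\<bar>t - s\<bar> < r" using t by (auto simp: dist_real_def abs_minus_commute)
      then have "(r/2)\<^sup>2 \<le> \<bar>t - s\<bar>\<^sup>2" using r(1) by (intro power_mono) auto
      then have "\<eta> \<le> (t - s)\<^sup>2" using \<eta>(2) by simp
      then show ?thesis using d(2)[of t] * r(3) by (simp add: z_def \<psi>_def)
    qed
    show "lam * z t + h t (D t - 2 * (t - s)) \<le> 0" if t: "t \<in> cball s (r/2)" "t \<in> {0<..<1}" for t
    proof -
      have "\<bar>t - s\<bar> \<le> r/2" using t(1) by (simp add: dist_real_def abs_minus_commute)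
      then have "G t \<le> - c" using c(3)[of t] t(2) r(1,2) by auto
      moreover have "lam * z t \<le> lam * (\<psi> t + \<eta>)"
        using lam_pos by (intro mult_left_mono) (auto simp: z_def)
      ultimately show ?thesis using \<eta>(3) by (simp add: G_def distrib_left)
    qed
  qed (use r(1) in auto)
  moreover have "?v 0 = w 0" "?v 1 = w 1" using r by (auto simp: dist_real_def)
  moreover have "w s < ?v s" using r(1) \<eta>(1) by (simp add: z_def \<psi>_def)
  ultimately show ?thesis using that[of ?v s] s by auto
qed

text \<open>
  At the end point a linear tilt takes the place of the parabola. That every small height \<open>\<eta>\<close> is
  available matters: arcs which meet at a vertex must be raised there by the same amount.
\<close>

lemma endpoint_bump:
  assumes w: "arc_subsolution lam h w" and "\<not> state_constraint_at_1 lam h w"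
  obtains \<eta>0 where "\<eta>0 > 0"
    "\<And>\<eta>. 0 < \<eta> \<Longrightarrow> \<eta> \<le> \<eta>0 \<Longrightarrow>
      \<exists>v. arc_subsolution lam h v \<and> (\<forall>t. w t \<le> v t) \<and> v 0 = w 0 \<and> v 1 = w 1 + \<eta>"
proof -
  obtain \<phi> \<delta> where "\<phi> C1_differentiable_on UNIV" and \<phi>1: "\<phi> 1 = w 1"
    and \<delta>: "\<delta> > 0" "\<And>t. t \<in> {1 - \<delta><..<1} \<Longrightarrow> \<phi> t \<le> w t"
    and neg: "lam * w 1 + h 1 (deriv \<phi> 1) < 0"
    using assms(2) unfolding state_constraint_at_1_def not_le by (auto simp: not_le)
  then obtain D where D: "\<And>t. (\<phi> has_real_derivative D t) (at t)" "continuous_on UNIV D"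
    by (auto simp: C1_differentiable_on_UNIV_iff)
  have neg: "lam * w 1 + h 1 (D 1) < 0" using neg DERIV_imp_deriv[OF D(1)] by simp
  have \<phi>_cont: "continuous_on S \<phi>" for S
    using DERIV_isCont[OF D(1)] by (simp add: continuous_at_imp_continuous_on)
  have "continuous_on {0..1} (\<lambda>\<kappa>. lam * w 1 + h 1 (D 1 + \<kappa>))"
    by (intro continuous_intros h_compose_continuous) auto
  then obtain c0 r1 where r1: "c0 > 0" "r1 > 0"
      "\<And>\<kappa>. \<kappa> \<in> {0..1} \<Longrightarrow> \<bar>\<kappa> - 0\<bar> < r1 \<Longrightarrow> lam * w 1 + h 1 (D 1 + \<kappa>) \<le> - c0"
    using negative_near[of "\<lambda>\<kappa>. lam * w 1 + h 1 (D 1 + \<kappa>)" 0] neg by auto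
  \<comment> \<open>The tilt increases the slope of the test function by \<open>\<kappa>\<close>, so it has to be small enough to
    keep the strict inequality at \<open>1\<close>.\<close>
  define \<kappa> where "\<kappa> = min 1 (r1 / 2)"
  have \<kappa>: "\<kappa> > 0" "lam * w 1 + h 1 (D 1 + \<kappa>) < 0"
  proof -
    show "\<kappa> > 0" using r1(2) by (simp add: \<kappa>_def)
    have "\<kappa> \<le> 1" "\<kappa> < r1" using r1(2) by (auto simp: \<kappa>_def min_less_iff_disj)
    then show "lam * w 1 + h 1 (D 1 + \<kappa>) < 0" using \<open>\<kappa> > 0\<close> r1(1) r1(3)[of \<kappa>] by auto
  qed
  define G where "G t = lam * \<phi> t + h t (D t + \<kappa>)" for t
  have "continuous_on {0..1} G"
    unfolding G_def
    by (intro continuous_intros \<phi>_cont h_compose_continuous continuous_on_subset[OF D(2)]) auto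
  moreover have "G 1 < 0" using \<kappa>(2) by (simp add: G_def \<phi>1)
  ultimately obtain c r0 where c: "c > 0" "r0 > 0"
      "\<And>t. t \<in> {0..1} \<Longrightarrow> \<bar>t - 1\<bar> < r0 \<Longrightarrow> G t \<le> - c"
    using negative_near[of G 1] by auto
  define r where "r = min (min r0 \<delta>) 1"
  have r: "r > 0" "r \<le> r0" "r \<le> \<delta>" "r \<le> 1" using c \<delta> by (auto simp: r_def)
  define \<eta>0 where "\<eta>0 = min (\<kappa> * (r/2)) (c / lam)"
  show ?thesis
  proof (rule that[of \<eta>0])
    show "\<eta>0 > 0" using \<kappa>(1) r(1) c(1) lam_pos by (simp add: \<eta>0_def)
    fix \<eta> :: real assume \<eta>: "0 < \<eta>" "\<eta> \<le> \<eta>0"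
    have \<eta>': "\<eta> \<le> \<kappa> * (r/2)" "lam * \<eta> \<le> c"
      using \<eta>(2) lam_pos by (auto simp: \<eta>0_def field_simps)
    define z where "z t = \<phi> t - \<kappa> * (1 - t) + \<eta>" for t
    let ?v = "\<lambda>t. if t \<in> {1 - r<..} then max (w t) (z t) else w t"
    have "arc_subsolution lam h ?v"
    proof (rule arc_subsolution_bump[OF w, where C="{1 - r/2..}" and Dz="\<lambda>t. D t + \<kappa>"])
      show "(z has_real_derivative D t + \<kappa>) (at t)" for t
        unfolding z_def by (auto intro!: derivative_eq_intros D(1))
      show "z t \<le> w t" if t: "t \<in> {1 - r<..} - {1 - r/2..}" for t
      proof -
        have "\<phi> t \<le> w t" using \<delta>(2)[of t] t r by auto
        moreover have "\<kappa> * (r/2) \<le> \<kappa> * (1 - t)" using t \<kappa>(1) by (intro mult_left_mono) auto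
        ultimately show ?thesis using \<eta>'(1) by (simp add: z_def)
      qed
      show "lam * z t + h t (D t + \<kappa>) \<le> 0" if t: "t \<in> {1 - r/2..}" "t \<in> {0<..<1}" for t
      proof -
        have "\<bar>t - 1\<bar> < r0" using t r by auto
        then have "G t \<le> - c" using c(3)[of t] t(2) by auto
        moreover have "lam * z t \<le> lam * (\<phi> t + \<eta>)"
          using lam_pos \<kappa>(1) t by (intro mult_left_mono) (auto simp: z_def)
        ultimately show ?thesis using \<eta>'(2) by (simp add: G_def distrib_left)
      qed
    qed (use r(1) in auto)
    moreover have "?v 0 = w 0" "?v 1 = w 1 + \<eta>" using r \<eta>(1) by (auto simp: z_def \<phi>1)
    moreover have "\<forall>t. w t \<le> ?v t" by auto
    ultimately show "\<exists>v. arc_subsolution lam h v \<and> (\<forall>t. w t \<le> v t) \<and> v 0 = w 0 \<and> v 1 = w 1 + \<eta>"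
      by blast
  qed
qed

end

section \<open>Comparison on an arc\<close>

text \<open>
  A function that touches \<open>v\<close> from below at \<open>1\<close> becomes admissible in the state constraint
  after a vertical translation.
\<close>

lemma state_constraint_at_1D:
  assumes "state_constraint_at_1 lam h v"
    and D: "\<And>t. (\<phi> has_real_derivative D t) (at t)" "continuous_on UNIV D"
    and "\<And>t. t \<in> {0..1} \<Longrightarrow> v 1 - \<phi> 1 \<le> v t - \<phi> t"
  shows "lam * v 1 + h 1 (D 1) \<ge> 0"
proof -
  define \<psi> where "\<psi> t = \<phi> t + (v 1 - \<phi> 1)" for t
  have \<psi>: "(\<psi> has_real_derivative D t) (at t)" for t
    unfolding \<psi>_def by (auto intro!: derivative_eq_intros D(1))
  then have "\<psi> C1_differentiable_on UNIV"
    using D(2) by (auto simp: C1_differentiable_on_UNIV_iff)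
  moreover have "\<exists>\<delta>>0. \<forall>t\<in>{1 - \<delta><..<1}. v t \<ge> \<psi> t"
  proof (intro exI[of _ 1] conjI ballI)
    show "\<psi> t \<le> v t" if "t \<in> {1 - 1<..<1}" for t
      using assms(4)[of t] that by (simp add: \<psi>_def)
  qed simp
  ultimately have "lam * \<psi> 1 + h 1 (deriv \<psi> 1) \<ge> 0"
    using assms(1) by (simp add: state_constraint_at_1_def \<psi>_def)
  then show ?thesis using DERIV_imp_deriv[OF \<psi>] by (simp add: \<psi>_def)
qed

context discounted_arc
begin

text \<open>
  Doubling of variables with the penalty \<open>(s - t + k * \<epsilon>)\<^sup>2 / \<epsilon>\<close>. The shift by \<open>k * \<epsilon>\<close> rewards \<open>s < t\<close>,
  and since \<open>k\<close> exceeds the Lipschitz constant \<open>L\<close> of \<open>w\<close>, a maximum with \<open>s = 1\<close> is impossible: moving \<open>s\<close> to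
  the left would gain more in the penalty than it loses in \<open>w\<close>. So the subsolution is tested in the open
  interval only, while \<open>t = 1\<close> is what the state constraint is made for. The term \<open>(t - s0)\<^sup>2\<close> localises
  both variables at \<open>s0\<close>. The Lipschitz bound also keeps the common slope \<open>2 * P\<close> bounded, so the two
  values of the Hamiltonian are close by uniform continuity.
\<close>

lemma comparison_at_maximum:
  assumes w: "arc_subsolution lam h w" and v: "arc_supersolution lam h v"
    and s0: "s0 \<in> {0<..1}" and sc: "s0 = 1 \<Longrightarrow> state_constraint_at_1 lam h v"
    and max: "\<And>t. t \<in> {0..1} \<Longrightarrow> w t - v t \<le> w s0 - v s0"
  shows "w s0 \<le> v s0"
proof (rule ccontr)
  assume "\<not> w s0 \<le> v s0"
  define c where "c = w s0 - v s0"
  have c: "c > 0" using \<open>\<not> w s0 \<le> v s0\<close> by (simp add: c_def)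
  have w_cont: "continuous_on {0..1} w" and v_cont: "continuous_on {0..1} v"
    using w v by (auto intro: arc_subsolution_continuous arc_supersolution_continuous)
  obtain a where "a \<in> {0..1}" "\<And>t. t \<in> {0..1} \<Longrightarrow> w a \<le> w t"
    using continuous_attains_inf[OF _ _ w_cont] by auto
  then obtain L where L: "L > 0" "\<And>a b. a \<in> {0..1} \<Longrightarrow> b \<in> {0..1} \<Longrightarrow> \<bar>w a - w b\<bar> \<le> L * \<bar>a - b\<bar>"
    using subsolution_Lipschitz[of "- w a"] w by (metis minus_minus)
  \<comment> \<open>\<open>Q\<close> will bound \<open>\<bar>P\<bar>\<close>, the penalised distance in units of \<open>\<epsilon>\<close>, and \<open>\<epsilon> * N\<close> will bound \<open>(t - s0)\<^sup>2\<close>.\<close>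
  define k where "k = L + 1"
  define Q where "Q = L + 2 * L * k + 1"
  define N where "N = L * Q + 2 * L * k"
  have pos: "k > 0" "Q > 1" "N > 0" "L * k > 0" using L(1) by (auto simp: k_def Q_def N_def add_pos_pos)
  obtain d where d: "d > 0" "\<And>s t p q. \<lbrakk>s \<in> {0..1}; t \<in> {0..1}; \<bar>p\<bar> \<le> 2 * Q + 2; \<bar>q\<bar> \<le> 2 * Q + 2;
      \<bar>s - t\<bar> < d; \<bar>p - q\<bar> < d\<rbrakk> \<Longrightarrow> \<bar>h s p - h t q\<bar> < lam * c / 2"
    using h_uniformly_continuous[of "lam * c / 2" "2 * Q + 2"] c lam_pos by auto
  \<comment> \<open>Points within distance \<open>2 * r\<close> of \<open>s0\<close> are positive, and less than \<open>1\<close> if \<open>s0\<close> is.\<close>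
  define e where "e = (if s0 < 1 then (1 - s0)/2 else 1)"
  have e: "e > 0" "s0 < 1 \<Longrightarrow> e = (1 - s0)/2" by (auto simp: e_def)
  define r where "r = min (min (d/2) 1) (min (s0/2) e)"
  have r: "r > 0" "r \<le> d/2" "r \<le> 1" "r \<le> s0/2" "r \<le> e"
    using d(1) s0 e(1) by (auto simp: r_def)
  define X where "X = Q + k + N + L * k + 1"
  define Y where "Y = min (min r (r\<^sup>2)) (min (c/4) s0)"
  define \<epsilon> where "\<epsilon> = Y / (2 * X)"
  have X: "X > 0" and Y: "Y > 0" using pos r(1) c s0 by (auto simp: X_def Y_def)
  have \<epsilon>: "\<epsilon> > 0" using X Y by (simp add: \<epsilon>_def)
  have small: "\<epsilon> * x < Y" if "x \<le> X" for x
  proof -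
    have "\<epsilon> * x \<le> \<epsilon> * X" using that \<epsilon> by (intro mult_left_mono) auto
    also have "\<dots> < Y" using X Y by (simp add: \<epsilon>_def)
    finally show ?thesis .
  qed
  have \<epsilon>_small: "\<epsilon> * (Q + k) < r" "\<epsilon> * N < r\<^sup>2" "\<epsilon> * (L * k) < c/4" "\<epsilon> * k < s0" "\<epsilon> * 1 < s0"
    using small[of "Q + k"] small[of N] small[of "L * k"] small[of k] small[of 1] pos
    unfolding X_def Y_def by auto
  define \<Phi> where "\<Phi> s t = w s - v t - (s - t + k * \<epsilon>)\<^sup>2 / \<epsilon> - (t - s0)\<^sup>2" for s t
  have "continuous_on ({0..1} \<times> {0..1}) (\<lambda>x. \<Phi> (fst x) (snd x))"
    unfolding \<Phi>_def using \<epsilon>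
    by (intro continuous_intros continuous_on_compose2[OF w_cont] continuous_on_compose2[OF v_cont]) auto
  then obtain s t where st: "s \<in> {0..1}" "t \<in> {0..1}"
    and \<Phi>_max: "\<And>a b. a \<in> {0..1} \<Longrightarrow> b \<in> {0..1} \<Longrightarrow> \<Phi> a b \<le> \<Phi> s t"
    using continuous_attains_sup[of "{0..1} \<times> {0..1::real}" "\<lambda>x. \<Phi> (fst x) (snd x)"]
    by (fastforce intro: compact_Times)
  define P where "P = (s - t + k * \<epsilon>) / \<epsilon>"
  have \<epsilon>P: "s - t = \<epsilon> * P - k * \<epsilon>" using \<epsilon> by (simp add: P_def)
  have penalty: "(s - t + k * \<epsilon>)\<^sup>2 / \<epsilon> = \<epsilon> * P\<^sup>2"
    using \<epsilon> by (simp add: P_def power2_eq_square)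
  have dist_st: "\<bar>s - t\<bar> \<le> \<epsilon> * (\<bar>P\<bar> + k)"
  proof -
    have "\<bar>s - t\<bar> \<le> \<bar>\<epsilon> * P\<bar> + \<bar>k * \<epsilon>\<bar>" unfolding \<epsilon>P by linarith
    also have "\<dots> = \<epsilon> * (\<bar>P\<bar> + k)" using \<epsilon> pos(1) by (simp add: abs_mult algebra_simps)
    finally show ?thesis .
  qed
  \<comment> \<open>Comparison with the pair \<open>(s0 - k * \<epsilon>, s0)\<close>, at which both penalties vanish.\<close>
  have lower: "c - \<epsilon> * (L * k) \<le> w s - v t - \<epsilon> * P\<^sup>2 - (t - s0)\<^sup>2"
  proof -
    have in01: "s0 - k * \<epsilon> \<in> {0..1}" "s0 \<in> {0..1}"
      using s0 \<epsilon>_small(4) mult_pos_pos[OF \<epsilon> pos(1)] unfolding mult.commute[of k] by auto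
    have "\<bar>w s0 - w (s0 - k * \<epsilon>)\<bar> \<le> L * \<bar>s0 - (s0 - k * \<epsilon>)\<bar>"
      using in01 by (intro L(2))
    also have "\<dots> = \<epsilon> * (L * k)" using pos(1) \<epsilon> by simp
    finally have "w (s0 - k * \<epsilon>) \<ge> w s0 - \<epsilon> * (L * k)" by linarith
    moreover have "\<Phi> (s0 - k * \<epsilon>) s0 \<le> \<Phi> s t" by (rule \<Phi>_max[OF in01])
    then have "w (s0 - k * \<epsilon>) - v s0 \<le> w s - v t - \<epsilon> * P\<^sup>2 - (t - s0)\<^sup>2"
      unfolding \<Phi>_def penalty by simp
    ultimately show ?thesis by (simp add: c_def)
  qed
  \<comment> \<open>Since \<open>w t - v t \<le> c\<close>, the penalties are paid for by the variation of \<open>w\<close> between \<open>s\<close> and \<open>t\<close>.\<close>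
  have estimate: "\<epsilon> * P\<^sup>2 + (t - s0)\<^sup>2 \<le> \<epsilon> * (L * \<bar>P\<bar> + 2 * L * k)"
  proof -
    have "\<bar>w s - w t\<bar> \<le> L * \<bar>s - t\<bar>" using st by (intro L(2))
    also have "\<dots> \<le> L * (\<epsilon> * (\<bar>P\<bar> + k))" using dist_st L(1) by (intro mult_left_mono) auto
    finally have "w s \<le> w t + \<epsilon> * (L * \<bar>P\<bar> + L * k)" by (simp add: algebra_simps)
    moreover have "w t - v t \<le> c" using max[OF st(2)] by (simp add: c_def)
    ultimately have "\<epsilon> * P\<^sup>2 + (t - s0)\<^sup>2 \<le> \<epsilon> * (L * \<bar>P\<bar> + L * k) + \<epsilon> * (L * k)"
      using lower by linarith
    then show ?thesis by (simp add: algebra_simps)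
  qed
  have P: "\<bar>P\<bar> \<le> Q"
  proof (rule ccontr)
    assume *: "\<not> \<bar>P\<bar> \<le> Q"
    have "\<epsilon> * P\<^sup>2 \<le> \<epsilon> * (L * \<bar>P\<bar> + 2 * L * k)"
      using estimate zero_le_power2[of "t - s0"] by linarith
    then have "P\<^sup>2 \<le> L * \<bar>P\<bar> + 2 * L * k" using \<epsilon> by simp
    also have "\<dots> \<le> L * \<bar>P\<bar> + (2 * L * k) * \<bar>P\<bar>"
    proof -
      have "(2 * L * k) * 1 \<le> (2 * L * k) * \<bar>P\<bar>"
        using * pos L(1) by (intro mult_left_mono) auto
      then show ?thesis by simp
    qed
    also have "\<dots> < Q * \<bar>P\<bar>" using * pos by (simp add: Q_def distrib_right)
    also have "\<dots> \<le> \<bar>P\<bar> * \<bar>P\<bar>" using * by (intro mult_right_mono) auto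
    finally show False by (simp add: power2_eq_square)
  qed
  have ts0: "\<bar>t - s0\<bar> < r"
  proof -
    have "\<epsilon> * (L * \<bar>P\<bar> + 2 * L * k) \<le> \<epsilon> * N"
      unfolding N_def using \<epsilon> L(1) P by (intro mult_left_mono add_right_mono) auto
    moreover have "0 \<le> \<epsilon> * P\<^sup>2" using \<epsilon> by simp
    ultimately have "(t - s0)\<^sup>2 < r\<^sup>2" using estimate \<epsilon>_small(2) by linarith
    then show ?thesis using r(1) power2_less_imp_less[of "\<bar>t - s0\<bar>" r] by simp
  qed
  have st_close: "\<bar>s - t\<bar> < r"
  proof -
    have "\<epsilon> * (\<bar>P\<bar> + k) \<le> \<epsilon> * (Q + k)" using \<epsilon> P by (intro mult_left_mono) auto
    then show ?thesis using dist_st \<epsilon>_small(1) by linarith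
  qed
  have "s \<noteq> 1"
  proof
    assume s1: "s = 1"
    have in01: "1 - \<epsilon> \<in> {0..1}" using \<epsilon> \<epsilon>_small(5) s0 by auto
    \<comment> \<open>Comparison with the pair \<open>(1 - \<epsilon>, t)\<close>.\<close>
    define a where "a = 1 - t + k * \<epsilon>"
    have "\<Phi> (1 - \<epsilon>) t \<le> \<Phi> 1 t" using \<Phi>_max[OF in01 st(2)] s1 by simp
    then have "w (1 - \<epsilon>) - (a - \<epsilon>)\<^sup>2 / \<epsilon> \<le> w 1 - a\<^sup>2 / \<epsilon>"
      by (simp add: \<Phi>_def a_def algebra_simps)
    moreover have "a\<^sup>2 / \<epsilon> - (a - \<epsilon>)\<^sup>2 / \<epsilon> = 2 * a - \<epsilon>"
      using \<epsilon> by (simp add: field_simps power2_eq_square)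
    moreover have "\<bar>w 1 - w (1 - \<epsilon>)\<bar> \<le> L * \<epsilon>" using L(2)[OF _ in01, of 1] \<epsilon> by simp
    ultimately have "2 * a \<le> L * \<epsilon> + \<epsilon>" by linarith
    also have "\<dots> = k * \<epsilon>" by (simp add: k_def algebra_simps)
    also have "\<dots> \<le> a" using st(2) by (simp add: a_def)
    finally have "a \<le> 0" by simp
    moreover have "a > 0" using st(2) mult_pos_pos[OF pos(1) \<epsilon>] by (auto simp: a_def)
    ultimately show False by simp
  qed
  moreover have "s > 0" "t > 0" using ts0 st_close r(4) s0 by auto
  ultimately have s01: "s \<in> {0<..<1}" using st by auto
  have sub: "lam * w s + h s (2 * P) \<le> 0"
  proof -
    have "lam * w s + h s (2 * (s - t + k * \<epsilon>) / \<epsilon>) \<le> 0"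
    proof (rule arc_subsolutionD[OF w s01 _ _ s01])
      show "((\<lambda>x. (x - t + k * \<epsilon>)\<^sup>2 / \<epsilon>) has_real_derivative 2 * (x - t + k * \<epsilon>) / \<epsilon>) (at x)" for x
        using \<epsilon> by (auto intro!: derivative_eq_intros)
      show "continuous_on UNIV (\<lambda>x. 2 * (x - t + k * \<epsilon>) / \<epsilon>)"
        using \<epsilon> by (intro continuous_intros) auto
      show "w x - (x - t + k * \<epsilon>)\<^sup>2 / \<epsilon> \<le> w s - (s - t + k * \<epsilon>)\<^sup>2 / \<epsilon>" if "x \<in> {0..1}" for x
        using \<Phi>_max[OF that st(2)] by (simp add: \<Phi>_def)
    qed
    then show ?thesis by (simp add: P_def)
  qed
  define \<phi> where "\<phi> x = - (s - x + k * \<epsilon>)\<^sup>2 / \<epsilon> - (x - s0)\<^sup>2" for x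
  define D where "D x = 2 * (s - x + k * \<epsilon>) / \<epsilon> - 2 * (x - s0)" for x
  have \<phi>: "(\<phi> has_real_derivative D x) (at x)" for x
    unfolding \<phi>_def D_def using \<epsilon> by (auto intro!: derivative_eq_intros simp: field_simps)
  have D_cont: "continuous_on UNIV D"
    unfolding D_def using \<epsilon> by (intro continuous_intros) auto
  have \<phi>_min: "v t - \<phi> t \<le> v x - \<phi> x" if "x \<in> {0..1}" for x
    using \<Phi>_max[OF st(1) that] by (simp add: \<Phi>_def \<phi>_def)
  have super: "lam * v t + h t (D t) \<ge> 0"
  proof (cases "t = 1")
    case True
    have "s0 = 1"
    proof (rule ccontr)
      assume "s0 \<noteq> 1"
      then show False using r(5) e(2) ts0 s0 True by auto
    qed
    then show ?thesis
      using state_constraint_at_1D[OF sc \<phi> D_cont] \<phi>_min True by auto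
  next
    case False
    then have "t \<in> {0<..<1}" using st(2) \<open>t > 0\<close> by auto
    then show ?thesis
      using \<phi>_min by (intro arc_supersolutionD[OF v _ \<phi> D_cont, where a=0 and b=1]) auto
  qed
  have D_t: "D t = 2 * P - 2 * (t - s0)" by (simp add: D_def P_def)
  have "\<bar>h t (D t) - h s (2 * P)\<bar> < lam * c / 2"
  proof (rule d(2))
    show "\<bar>D t\<bar> \<le> 2 * Q + 2" unfolding D_t using P ts0 r(3) by (auto simp: abs_le_iff abs_less_iff)
    show "\<bar>D t - 2 * P\<bar> < d" unfolding D_t using ts0 r(2) by (auto simp: abs_less_iff)
    show "\<bar>t - s\<bar> < d" using st_close r(1,2) by linarith
  qed (use st P in auto)
  then have "h t (D t) - h s (2 * P) < lam * c / 2" by (rule abs_less_iff[THEN iffD1, THEN conjunct1])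
  then have "lam * (w s - v t) < lam * (c / 2)" using sub super by (simp add: right_diff_distrib)
  then have "w s - v t < c / 2" using lam_pos by simp
  moreover have "0 \<le> \<epsilon> * P\<^sup>2" "0 \<le> (t - s0)\<^sup>2" using \<epsilon> by auto
  ultimately show False using lower \<epsilon>_small(3) c by linarith
qed

lemma comparison_from_left_endpoint:
  assumes w: "arc_subsolution lam h w" and v: "arc_supersolution lam h v"
    and sc: "state_constraint_at_1 lam h v" and le: "w 0 \<le> v 0"
  shows "w 1 \<le> v 1"
proof -
  have "continuous_on {0..1} (\<lambda>t. w t - v t)"
    using w v by (intro continuous_intros) (auto intro: arc_subsolution_continuous arc_supersolution_continuous)
  then obtain s0 where s0: "s0 \<in> {0..1}" "\<And>t. t \<in> {0..1} \<Longrightarrow> w t - v t \<le> w s0 - v s0"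
    using continuous_attains_sup[of "{0..1::real}" "\<lambda>t. w t - v t"] by fastforce
  have "w s0 \<le> v s0"
    using comparison_at_maximum[OF w v _ sc s0(2)] le s0(1) by (cases "s0 = 0") auto
  then show ?thesis using s0(2)[of 1] by auto
qed

section \<open>The terminal value of the maximal subsolution\<close>

text \<open>
  Lowering a subsolution by \<open>\<delta>\<close> leaves a slack \<open>lam * \<delta>\<close> in the equation, half of which pays for
  the tilt itself and half for the change of the Hamiltonian when slopes grow by \<open>\<kappa>\<close>. Below the level
  \<open>lam * M\<close> slopes are bounded, so by uniform continuity one \<open>\<kappa>\<close> serves all subsolutions above \<open>- M\<close>.
\<close>

lemma subsolution_shift:
  assumes "\<delta> > 0"
  obtains \<kappa> where "\<kappa> > 0"
    "\<And>w. \<lbrakk>arc_subsolution lam h w; \<And>s. s \<in> {0..1} \<Longrightarrow> - M \<le> w s\<rbrakk>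
      \<Longrightarrow> arc_subsolution lam h (\<lambda>s. w s - \<delta> + \<kappa> * s)"
proof -
  obtain R where R: "R > 0" "\<And>s p. s \<in> {0..1} \<Longrightarrow> h s p \<le> lam * M \<Longrightarrow> \<bar>p\<bar> \<le> R"
    using slope_bound by blast
  have "lam * \<delta> / 2 > 0" using assms lam_pos by simp
  then obtain d where d: "d > 0" "\<And>s t p q. \<lbrakk>s \<in> {0..1}; t \<in> {0..1}; \<bar>p\<bar> \<le> R + 1; \<bar>q\<bar> \<le> R + 1;
      \<bar>s - t\<bar> < d; \<bar>p - q\<bar> < d\<rbrakk> \<Longrightarrow> \<bar>h s p - h t q\<bar> < lam * \<delta> / 2"
    using h_uniformly_continuous[of "lam * \<delta> / 2" "R + 1"] by blast
  define \<kappa> where "\<kappa> = min (min 1 (d/2)) (\<delta>/2)"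
  have \<kappa>: "\<kappa> > 0" "\<kappa> \<le> 1" "\<kappa> < d" "\<kappa> \<le> \<delta>/2" using d(1) assms by (auto simp: \<kappa>_def min_less_iff_disj)
  have "arc_subsolution lam h (\<lambda>s. w s - \<delta> + \<kappa> * s)"
    if w: "arc_subsolution lam h w" and M: "\<And>s. s \<in> {0..1} \<Longrightarrow> - M \<le> w s" for w
  proof (rule arc_subsolutionI)
    show "continuous_on {0..1} (\<lambda>s. w s - \<delta> + \<kappa> * s)"
      by (intro continuous_intros arc_subsolution_continuous[OF w])
  next
    fix \<phi> D :: "real \<Rightarrow> real" and s e :: real
    assume s: "s \<in> {0<..<1}" and D: "\<And>t. (\<phi> has_real_derivative D t) (at t)" "continuous_on UNIV D"
      and e: "e > 0" "\<And>t. \<bar>t - s\<bar> < e \<Longrightarrow> w t - \<delta> + \<kappa> * t - \<phi> t \<le> w s - \<delta> + \<kappa> * s - \<phi> s"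
    have D': "((\<lambda>t. \<phi> t - \<kappa> * t) has_real_derivative D t - \<kappa>) (at t)" for t
      by (auto intro!: derivative_eq_intros D(1))
    have D'_cont: "continuous_on UNIV (\<lambda>t. D t - \<kappa>)" by (intro continuous_intros D(2))
    have touch: "w t - (\<phi> t - \<kappa> * t) \<le> w s - (\<phi> s - \<kappa> * s)" if "t \<in> {s - e/2..s + e/2}" for t
    proof -
      have "\<bar>t - s\<bar> < e" using that e(1) by auto
      from e(2)[OF this] show ?thesis by simp
    qed
    have s': "s \<in> {s - e/2<..<s + e/2}" using e(1) by simp
    have sub: "lam * w s + h s (D s - \<kappa>) \<le> 0"
      by (rule arc_subsolutionD[OF w s D' D'_cont s' touch])
    have "h s (D s - \<kappa>) \<le> lam * M"
      by (rule subsolution_test_slope[OF w s D' D'_cont s' touch]) (use M s in auto)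
    then have slope: "\<bar>D s - \<kappa>\<bar> \<le> R" using R(2)[of s "D s - \<kappa>"] s by auto
    have "\<bar>h s (D s) - h s (D s - \<kappa>)\<bar> < lam * \<delta> / 2"
    proof (rule d(2))
      show "\<bar>D s\<bar> \<le> R + 1" "\<bar>D s - \<kappa>\<bar> \<le> R + 1" using slope \<kappa> by linarith+
    qed (use s d(1) \<kappa> in auto)
    then have "h s (D s) - h s (D s - \<kappa>) < lam * (\<delta>/2)"
      unfolding abs_less_iff times_divide_eq_right by (rule conjunct1)
    moreover have "lam * (w s - \<delta> + \<kappa> * s) \<le> lam * (w s - \<delta>/2)"
    proof -
      have "\<kappa> * s \<le> \<kappa> * 1" using s \<kappa> by (intro mult_left_mono) auto
      then show ?thesis using \<kappa>(4) lam_pos by (intro mult_left_mono) auto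
    qed
    ultimately show "lam * (w s - \<delta> + \<kappa> * s) + h s (D s) \<le> 0"
      using sub by (simp add: right_diff_distrib)
  qed
  then show ?thesis using that[OF \<kappa>(1)] by blast
qed

lemma terminal_value_upper:
  assumes "arc_subsolution lam h w" "w 0 \<le> \<alpha>"
  shows "w 1 \<le> max_subsolution lam h \<alpha> 1"
proof -
  obtain B where B: "\<And>w s. arc_subsolution lam h w \<Longrightarrow> s \<in> {0..1} \<Longrightarrow> w s \<le> B"
    using subsolution_upper_bound by blast
  show ?thesis
    unfolding max_subsolution_def
    by (rule cSup_upper) (use assms B[of _ 1] in \<open>auto intro!: bdd_aboveI[of _ B]\<close>)
qed

text \<open>
  The set of competitors is nonempty because low constants are subsolutions, so the supremum is
  the least upper bound.
\<close>

lemma terminal_value_least: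
  assumes "\<And>w. arc_subsolution lam h w \<Longrightarrow> w 0 \<le> \<alpha> \<Longrightarrow> w 1 \<le> b"
  shows "max_subsolution lam h \<alpha> 1 \<le> b"
proof -
  obtain K where K: "\<And>c. c \<le> K \<Longrightarrow> arc_subsolution lam h (\<lambda>_. c)"
    using constant_subsolution_bound by blast
  show ?thesis
    unfolding max_subsolution_def
  proof (rule cSup_least)
    show "{w 1 |w. arc_subsolution lam h w \<and> w 0 \<le> \<alpha>} \<noteq> {}"
      using K[of "min K \<alpha>"] by auto
  qed (use assms in auto)
qed

text \<open>
  Every competitor for \<open>\<alpha>'\<close>, lowered by \<open>\<alpha>' - \<alpha>\<close> and tilted, competes for \<open>\<alpha>\<close> and gains \<open>\<kappa>\<close> at \<open>1\<close>. The
  maximum with a low constant provides the common lower bound which makes \<open>\<kappa>\<close> the same for all.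
\<close>

lemma terminal_value_strict_contraction:
  assumes "\<alpha> < \<alpha>'"
  shows "max_subsolution lam h \<alpha>' 1 - max_subsolution lam h \<alpha> 1 < \<alpha>' - \<alpha>"
proof -
  obtain K where K: "\<And>c. c \<le> K \<Longrightarrow> arc_subsolution lam h (\<lambda>_. c)"
    using constant_subsolution_bound by blast
  define M where "M = - min K \<alpha>'"
  obtain \<kappa> where \<kappa>: "\<kappa> > 0"
    "\<And>w. \<lbrakk>arc_subsolution lam h w; \<And>s. s \<in> {0..1} \<Longrightarrow> - M \<le> w s\<rbrakk>
      \<Longrightarrow> arc_subsolution lam h (\<lambda>s. w s - (\<alpha>' - \<alpha>) + \<kappa> * s)"
    using subsolution_shift[of "\<alpha>' - \<alpha>"] assms by auto
  have "max_subsolution lam h \<alpha>' 1 \<le> max_subsolution lam h \<alpha> 1 + (\<alpha>' - \<alpha>) - \<kappa>"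
  proof (rule terminal_value_least)
    fix w assume w: "arc_subsolution lam h w" "w 0 \<le> \<alpha>'"
    define v where "v s = max (w s) (- M)" for s
    have "arc_subsolution lam h v"
      unfolding v_def by (intro arc_subsolution_max w K) (simp add: M_def)
    then have "arc_subsolution lam h (\<lambda>s. v s - (\<alpha>' - \<alpha>) + \<kappa> * s)"
      by (rule \<kappa>(2)) (simp add: v_def)
    from terminal_value_upper[OF this, of \<alpha>]
    have "v 1 - (\<alpha>' - \<alpha>) + \<kappa> \<le> max_subsolution lam h \<alpha> 1"
      using w(2) by (simp add: v_def M_def)
    then show "w 1 \<le> max_subsolution lam h \<alpha> 1 + (\<alpha>' - \<alpha>) - \<kappa>"
      by (simp add: v_def)
  qed
  then show ?thesis using \<kappa>(1) by linarith
qed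

lemma terminal_value_mono:
  "\<alpha> \<le> \<alpha>' \<Longrightarrow> max_subsolution lam h \<alpha> 1 \<le> max_subsolution lam h \<alpha>' 1"
  by (intro terminal_value_least terminal_value_upper) auto

lemma terminal_value_bounds:
  obtains a b where "\<And>\<alpha>. \<alpha> \<le> a \<Longrightarrow> \<alpha> \<le> max_subsolution lam h \<alpha> 1"
    "\<And>\<alpha>. max_subsolution lam h \<alpha> 1 \<le> b"
proof -
  obtain B where B: "\<And>w s. arc_subsolution lam h w \<Longrightarrow> s \<in> {0..1} \<Longrightarrow> w s \<le> B"
    using subsolution_upper_bound by blast
  obtain K where K: "\<And>c. c \<le> K \<Longrightarrow> arc_subsolution lam h (\<lambda>_. c)"
    using constant_subsolution_bound by blast
  show ?thesis
    using that[of K B] terminal_value_upper[OF K] terminal_value_least[where b=B] B[of _ 1] by auto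
qed

end

section \<open>Functions on a network\<close>

lemma inverse_arc_apply: "s \<in> {0..1} \<Longrightarrow> inverse_arc \<gamma> s = \<gamma> (1 - s)"
  by (simp add: inverse_arc_def reversepath_def)

lemma inverse_arc_inverse_arc: "\<gamma> \<in> extensional {0..1} \<Longrightarrow> inverse_arc (inverse_arc \<gamma>) = \<gamma>"
  by (auto simp: inverse_arc_def reversepath_def extensional_def restrict_def fun_eq_iff)

locale discounted_network =
  fixes A :: "(real \<Rightarrow> real^'n) set"
    and H :: "(real \<Rightarrow> real^'n) \<Rightarrow> real \<Rightarrow> real \<Rightarrow> real"
    and lam :: real
  assumes network: "network A" and hamiltonians: "hamiltonians A H" and lam_pos: "lam > 0"
begin

lemma finite_arcs: "finite A"
  and inverse_arc_in: "\<gamma> \<in> A \<Longrightarrow> inverse_arc \<gamma> \<in> A"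
  and inverse_inverse: "\<gamma> \<in> A \<Longrightarrow> inverse_arc (inverse_arc \<gamma>) = \<gamma>"
  and arc_continuous: "\<gamma> \<in> A \<Longrightarrow> continuous_on {0..1} \<gamma>"
  using network
  by (auto simp: network_def regular_simple_curve_def simple_path_def path_def inverse_arc_inverse_arc)

lemma discounted_arc: "\<gamma> \<in> A \<Longrightarrow> discounted_arc lam (H \<gamma>)"
  using hamiltonians lam_pos by (auto simp: hamiltonians_def discounted_arc_def)

lemma carrier_eq: "carrier_of A = (\<Union>\<gamma>\<in>A. \<gamma> ` {0..1})"
  by (simp add: carrier_of_def path_image_def)

lemma arc_in_carrier: "\<gamma> \<in> A \<Longrightarrow> s \<in> {0..1} \<Longrightarrow> \<gamma> s \<in> carrier_of A"
  unfolding carrier_eq by blast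

lemma vertices_eq: "vertices A = (\<lambda>\<gamma>. \<gamma> 1) ` A"
proof
  show "vertices A \<subseteq> (\<lambda>\<gamma>. \<gamma> 1) ` A"
  proof
    fix x assume "x \<in> vertices A"
    then consider \<gamma> where "\<gamma> \<in> A" "x = \<gamma> 0" | \<gamma> where "\<gamma> \<in> A" "x = \<gamma> 1"
      by (auto simp: vertices_def pathstart_def pathfinish_def)
    then show "x \<in> (\<lambda>\<gamma>. \<gamma> 1) ` A"
    proof cases
      case 1
      then have "x = inverse_arc \<gamma> 1" by (simp add: inverse_arc_apply)
      then show ?thesis using inverse_arc_in[OF 1(1)] by blast
    qed auto
  qed
qed (auto simp: vertices_def pathfinish_def)

lemma start_in_vertices: "\<gamma> \<in> A \<Longrightarrow> \<gamma> 0 \<in> vertices A"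
  and finish_in_vertices: "\<gamma> \<in> A \<Longrightarrow> \<gamma> 1 \<in> vertices A"
  by (auto simp: vertices_def pathstart_def pathfinish_def)

lemma arcs_meet_at_endpoints:
  assumes "\<gamma> \<in> A" "\<gamma>' \<in> A" "s \<in> {0..1}" "t \<in> {0..1}" and eq: "\<gamma> s = \<gamma>' t"
  shows "\<gamma> = \<gamma>' \<and> s = t \<or> \<gamma> = inverse_arc \<gamma>' \<and> s = 1 - t \<or> s \<in> {0, 1} \<and> t \<in> {0, 1}"
proof -
  have disjoint: "\<gamma>1 ` {0<..<1} \<inter> \<gamma>2 ` {0..1} = {}"
    if "\<gamma>1 \<in> A" "\<gamma>2 \<in> A" "\<gamma>1 \<noteq> \<gamma>2" "\<gamma>1 \<noteq> inverse_arc \<gamma>2" for \<gamma>1 \<gamma>2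
    using network that by (auto simp: network_def)
  have inj: "loop_free \<gamma>'"
    using network assms(2) by (auto simp: network_def regular_simple_curve_def simple_path_def)
  consider "\<gamma> = \<gamma>'" | "\<gamma> = inverse_arc \<gamma>'" | "\<gamma> \<noteq> \<gamma>'" "\<gamma> \<noteq> inverse_arc \<gamma>'" by blast
  then show ?thesis
  proof cases
    case 1
    then show ?thesis using inj assms(3-5) by (fastforce simp: loop_free_def)
  next
    case 2
    then have "\<gamma>' (1 - s) = \<gamma>' t" using eq assms(3) by (simp add: inverse_arc_apply)
    moreover have "1 - s \<in> {0..1}" using assms(3) by auto
    ultimately have "1 - s = t \<or> 1 - s = 0 \<and> t = 1 \<or> 1 - s = 1 \<and> t = 0"
      using inj assms(4) unfolding loop_free_def by blast
    then show ?thesis using 2 by auto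
  next
    case 3
    then have "\<gamma>' \<noteq> inverse_arc \<gamma>" using inverse_inverse[OF assms(2)] inverse_inverse[OF assms(1)] by auto
    then have "s \<notin> {0<..<1}" "t \<notin> {0<..<1}"
      using disjoint[OF assms(1,2) 3] disjoint[OF assms(2,1) 3(1)[symmetric]] eq assms(3,4)
      by (metis IntI imageI empty_iff)+
    then show ?thesis using assms(3,4) by auto
  qed
qed

text \<open>
  An arc is a continuous map from a compact space onto its image, hence a closed map, and so
  continuity can be tested after composition with it.
\<close>

lemma continuous_on_carrier:
  fixes u :: "real^'n \<Rightarrow> real"
  assumes "\<And>\<gamma>. \<gamma> \<in> A \<Longrightarrow> continuous_on {0..1} (u \<circ> \<gamma>)"
  shows "continuous_on (carrier_of A) u"
  unfolding carrier_eq
proof (rule continuous_on_closed_Union[OF finite_arcs])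
  fix \<gamma> assume \<gamma>: "\<gamma> \<in> A"
  have cont: "continuous_on {0..1} \<gamma>" using \<gamma> by (rule arc_continuous)
  show closed: "closed (\<gamma> ` {0..1})"
    using cont by (intro compact_imp_closed compact_continuous_image) auto
  have "closed (u -` C \<inter> \<gamma> ` {0..1})" if "closed C" for C
  proof -
    have "compact (\<gamma> ` ((u \<circ> \<gamma>) -` C \<inter> {0..1}))"
    proof (rule compact_continuous_image)
      have "closed ((u \<circ> \<gamma>) -` C \<inter> {0..1})"
        using assms[OF \<gamma>] that continuous_on_closed_vimage[of "{0..1}" "u \<circ> \<gamma>"] by auto
      then show "compact ((u \<circ> \<gamma>) -` C \<inter> {0..1})"
        by (metis Int_absorb Int_assoc closed_Int_compact compact_Icc)
    qed (use cont in \<open>auto elim: continuous_on_subset\<close>)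
    moreover have "u -` C \<inter> \<gamma> ` {0..1} = \<gamma> ` ((u \<circ> \<gamma>) -` C \<inter> {0..1})" by auto
    ultimately show ?thesis by (simp add: compact_imp_closed)
  qed
  then show "continuous_on (\<gamma> ` {0..1}) u"
    using continuous_on_closed_vimage[OF closed] by blast
qed

lemma arc_subsolution_along_inverse:
  assumes "\<gamma> \<in> A" "arc_subsolution lam (H (inverse_arc \<gamma>)) w"
  shows "arc_subsolution lam (H \<gamma>) (\<lambda>s. w (1 - s))"
proof (rule arc_subsolution_cong[OF _ _ arc_subsolution_reverse[OF assms(2)]])
  fix s p :: real assume "s \<in> {0..1}"
  then have "1 - s \<in> {0..1}" by auto
  then show "H (inverse_arc \<gamma>) (1 - s) (- p) = H \<gamma> s p"
    using hamiltonians assms(1) by (simp add: hamiltonians_def)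
qed simp

text \<open>
  Functions on the arcs come from one function on the network if they respect the inversion of arcs
  and depend at terminal points on the vertex only. Initial points are then covered as terminal points
  of the inverse arcs.
\<close>

lemma glue_arc_subsolutions:
  assumes sub: "\<And>\<gamma>. \<gamma> \<in> A \<Longrightarrow> arc_subsolution lam (H \<gamma>) (w \<gamma>)"
    and reverse: "\<And>\<gamma> s. \<gamma> \<in> A \<Longrightarrow> s \<in> {0..1} \<Longrightarrow> w (inverse_arc \<gamma>) s = w \<gamma> (1 - s)"
    and vertex: "\<And>\<gamma>. \<gamma> \<in> A \<Longrightarrow> w \<gamma> 1 = c (\<gamma> 1)"
  obtains v where "network_subsolution lam A H v"
    "\<And>\<gamma> s. \<gamma> \<in> A \<Longrightarrow> s \<in> {0..1} \<Longrightarrow> v (\<gamma> s) = w \<gamma> s"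
proof -
  have endpoint: "w \<gamma> s = c (\<gamma> s)" if "\<gamma> \<in> A" "s \<in> {0, 1}" for \<gamma> s
    using vertex[OF that(1)] vertex[OF inverse_arc_in[OF that(1)]] reverse[OF that(1), of 1] that(2)
    by (auto simp: inverse_arc_apply)
  have unique: "w \<gamma> s = w \<gamma>' t"
    if *: "\<gamma> \<in> A" "\<gamma>' \<in> A" "s \<in> {0..1}" "t \<in> {0..1}" "\<gamma> s = \<gamma>' t" for \<gamma> \<gamma>' s t
    using arcs_meet_at_endpoints[OF *] endpoint[OF *(1), of s] endpoint[OF *(2), of t]
      reverse[OF *(2), of s] * by auto
  define v where "v y = (THE r. \<exists>\<gamma>\<in>A. \<exists>s\<in>{0..1}. y = \<gamma> s \<and> r = w \<gamma> s)" for y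
  have v: "v (\<gamma> s) = w \<gamma> s" if "\<gamma> \<in> A" "s \<in> {0..1}" for \<gamma> s
    unfolding v_def
  proof (rule the_equality)
    show "\<exists>\<gamma>'\<in>A. \<exists>t\<in>{0..1}. \<gamma> s = \<gamma>' t \<and> w \<gamma> s = w \<gamma>' t" using that by blast
    show "r = w \<gamma> s" if *: "\<exists>\<gamma>'\<in>A. \<exists>t\<in>{0..1}. \<gamma> s = \<gamma>' t \<and> r = w \<gamma>' t" for r
    proof -
      obtain \<gamma>' t where "\<gamma>' \<in> A" "t \<in> {0..1}" "\<gamma> s = \<gamma>' t" "r = w \<gamma>' t" using * by blast
      then show ?thesis using unique[OF \<open>\<gamma> \<in> A\<close> _ \<open>s \<in> {0..1}\<close>] by simp
    qed
  qed
  have sub_v: "arc_subsolution lam (H \<gamma>) (v \<circ> \<gamma>)" if "\<gamma> \<in> A" for \<gamma>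
    by (rule arc_subsolution_cong[OF _ _ sub[OF that]]) (use v that in auto)
  then have "network_subsolution lam A H v"
    unfolding network_subsolution_def
    by (auto intro: continuous_on_carrier arc_subsolution_continuous)
  then show ?thesis using v that by blast
qed

text \<open>
  The bumps \<open>b\<close> are given arc by arc, with no relation between an arc and its inverse. Taking along each
  arc the larger of the two prescriptions restores symmetry. At a terminal point the bump of the
  inverse arc has no effect, since \<open>b\<close> does not change initial values, so the vertex value is \<open>c\<close>.
\<close>

lemma raise_network_subsolution:
  assumes u: "network_subsolution lam A H u"
    and b: "\<And>\<gamma>. \<gamma> \<in> A \<Longrightarrow> arc_subsolution lam (H \<gamma>) (b \<gamma>)"
      "\<And>\<gamma> s. \<gamma> \<in> A \<Longrightarrow> s \<in> {0..1} \<Longrightarrow> u (\<gamma> s) \<le> b \<gamma> s"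
      "\<And>\<gamma>. \<gamma> \<in> A \<Longrightarrow> b \<gamma> 0 = u (\<gamma> 0)" "\<And>\<gamma>. \<gamma> \<in> A \<Longrightarrow> b \<gamma> 1 = c (\<gamma> 1)"
  obtains v where "network_subsolution lam A H v"
    "\<And>\<gamma> s. \<gamma> \<in> A \<Longrightarrow> s \<in> {0..1} \<Longrightarrow> b \<gamma> s \<le> v (\<gamma> s)"
proof -
  define w where "w \<gamma> s = max (b \<gamma> s) (b (inverse_arc \<gamma>) (1 - s))" for \<gamma> s
  have sub: "arc_subsolution lam (H \<gamma>) (w \<gamma>)" if "\<gamma> \<in> A" for \<gamma>
    unfolding w_def
    by (intro arc_subsolution_max b(1) arc_subsolution_along_inverse that inverse_arc_in)
  have reverse: "w (inverse_arc \<gamma>) s = w \<gamma> (1 - s)" if "\<gamma> \<in> A" "s \<in> {0..1}" for \<gamma> s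
    using inverse_inverse[OF that(1)] by (simp add: w_def max.commute)
  have vertex: "w \<gamma> 1 = c (\<gamma> 1)" if "\<gamma> \<in> A" for \<gamma>
    using b(3)[OF inverse_arc_in[OF that]] b(2)[OF that, of 1] b(4)[OF that]
    by (simp add: w_def inverse_arc_apply)
  obtain v where v: "network_subsolution lam A H v"
    "\<And>\<gamma> s. \<gamma> \<in> A \<Longrightarrow> s \<in> {0..1} \<Longrightarrow> v (\<gamma> s) = w \<gamma> s"
    using glue_arc_subsolutions[of w c, OF sub reverse vertex] by blast
  show ?thesis by (rule that[OF v(1)]) (simp add: v(2) w_def)
qed

section \<open>Existence by Perron's method\<close>

lemma uniform_over_arcs:
  assumes "\<And>\<gamma>. \<gamma> \<in> A \<Longrightarrow> \<exists>c::real. \<forall>x\<ge>c. P \<gamma> x"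
  shows "\<exists>c. \<forall>\<gamma>\<in>A. \<forall>x\<ge>c. P \<gamma> x"
proof -
  have "\<forall>\<^sub>F x in at_top. \<forall>\<gamma>\<in>A. P \<gamma> x"
    by (rule eventually_ball_finite[OF finite_arcs])
       (use assms in \<open>auto simp: eventually_at_top_linorder\<close>)
  then show ?thesis by (auto simp: eventually_at_top_linorder)
qed

lemma low_constants_are_subsolutions:
  obtains K where "\<And>\<gamma> c. \<gamma> \<in> A \<Longrightarrow> c \<le> K \<Longrightarrow> arc_subsolution lam (H \<gamma>) (\<lambda>_. c)"
proof -
  have "\<exists>K. \<forall>\<gamma>\<in>A. \<forall>x\<ge>K. arc_subsolution lam (H \<gamma>) (\<lambda>_. - x)"
  proof (rule uniform_over_arcs)
    fix \<gamma> assume "\<gamma> \<in> A"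
    then interpret discounted_arc lam "H \<gamma>" by (rule discounted_arc)
    obtain K where "\<And>c. c \<le> K \<Longrightarrow> arc_subsolution lam (H \<gamma>) (\<lambda>_. c)"
      using constant_subsolution_bound by blast
    then show "\<exists>K. \<forall>x\<ge>K. arc_subsolution lam (H \<gamma>) (\<lambda>_. - x)" by (intro exI[of _ "- K"]) auto
  qed
  then obtain K where K: "\<And>\<gamma> x. \<gamma> \<in> A \<Longrightarrow> x \<ge> K \<Longrightarrow> arc_subsolution lam (H \<gamma>) (\<lambda>_. - x)" by blast
  have "arc_subsolution lam (H \<gamma>) (\<lambda>_. c)" if "\<gamma> \<in> A" "c \<le> - K" for \<gamma> c
    using K[OF that(1), of "- c"] that(2) by simp
  then show ?thesis using that by blast
qed

text \<open>
  The competitors are cut off at a low constant \<open>K\<close> to have the Lipschitz bound which keeps the supremum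
  a subsolution. A subsolution above \<open>u\<close> is above \<open>K\<close>, hence a competitor itself.
\<close>

lemma maximal_network_subsolution:
  obtains u where "network_subsolution lam A H u"
    "\<And>v \<gamma> s. \<lbrakk>network_subsolution lam A H v; \<And>y. y \<in> carrier_of A \<Longrightarrow> u y \<le> v y;
        \<gamma> \<in> A; s \<in> {0..1}\<rbrakk> \<Longrightarrow> v (\<gamma> s) \<le> u (\<gamma> s)"
proof -
  obtain K where K: "\<And>\<gamma> c. \<gamma> \<in> A \<Longrightarrow> c \<le> K \<Longrightarrow> arc_subsolution lam (H \<gamma>) (\<lambda>_. c)"
    using low_constants_are_subsolutions by blast
  define S where "S = {v. network_subsolution lam A H v \<and> (\<forall>y\<in>carrier_of A. K \<le> v y)}"
  define u where "u y = (SUP v\<in>S. v y)" for y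
  have "(\<lambda>_. K) \<in> S"
    using K by (simp add: S_def network_subsolution_def o_def)
  then have "S \<noteq> {}" by blast
  have bdd: "bdd_above ((\<lambda>v. v (\<gamma> s)) ` S)" if \<gamma>: "\<gamma> \<in> A" and s: "s \<in> {0..1}" for \<gamma> s
  proof -
    interpret discounted_arc lam "H \<gamma>" using \<gamma> by (rule discounted_arc)
    obtain B where "\<And>w s. arc_subsolution lam (H \<gamma>) w \<Longrightarrow> s \<in> {0..1} \<Longrightarrow> w s \<le> B"
      using subsolution_upper_bound by blast
    from this[of "_ \<circ> \<gamma>", OF _ s] show ?thesis
      using \<gamma> by (intro bdd_aboveI[of _ B]) (auto simp: S_def network_subsolution_def)
  qed
  have upper: "v (\<gamma> s) \<le> u (\<gamma> s)" if "v \<in> S" "\<gamma> \<in> A" "s \<in> {0..1}" for v \<gamma> s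
    unfolding u_def by (rule cSUP_upper[OF that(1) bdd[OF that(2,3)]])
  have sub: "arc_subsolution lam (H \<gamma>) (u \<circ> \<gamma>)" if \<gamma>: "\<gamma> \<in> A" for \<gamma>
  proof -
    interpret discounted_arc lam "H \<gamma>" using \<gamma> by (rule discounted_arc)
    have "arc_subsolution lam (H \<gamma>) (\<lambda>s. SUP w\<in>(\<lambda>v. v \<circ> \<gamma>) ` S. w s)"
    proof (rule subsolution_Sup[where M="- K"])
      show "- (- K) \<le> w s" if "w \<in> (\<lambda>v. v \<circ> \<gamma>) ` S" "s \<in> {0..1}" for w s
        using that arc_in_carrier[OF \<gamma>] by (auto simp: S_def)
    qed (use \<open>S \<noteq> {}\<close> \<gamma> in \<open>auto simp: S_def network_subsolution_def\<close>)
    then show ?thesis by (simp add: u_def o_def image_image)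
  qed
  then have u: "network_subsolution lam A H u"
    unfolding network_subsolution_def
    by (auto intro: continuous_on_carrier arc_subsolution_continuous)
  have "v (\<gamma> s) \<le> u (\<gamma> s)"
    if "network_subsolution lam A H v" "\<And>y. y \<in> carrier_of A \<Longrightarrow> u y \<le> v y" "\<gamma> \<in> A" "s \<in> {0..1}" for v \<gamma> s
  proof (rule upper[OF _ that(3,4)])
    have "K \<le> u y" if "y \<in> carrier_of A" for y
      using that upper[OF \<open>(\<lambda>_. K) \<in> S\<close>] by (auto simp: carrier_eq)
    then show "v \<in> S" using that(1,2) unfolding S_def by force
  qed
  then show ?thesis using that u by blast
qed

text \<open>
  A maximal subsolution admits no bump. An interior failure of the supersolution inequality allows
  one on a single arc. At a vertex, bumps of equal height are needed on all arcs that end there, which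
  is why the state constraint holds on at least one of these arcs, but possibly on no more.
\<close>

lemma network_solution_exists: "\<exists>u. network_solution lam A H u"
proof -
  obtain u where u: "network_subsolution lam A H u"
    and maximal: "\<And>v \<gamma> s. \<lbrakk>network_subsolution lam A H v; \<And>y. y \<in> carrier_of A \<Longrightarrow> u y \<le> v y;
        \<gamma> \<in> A; s \<in> {0..1}\<rbrakk> \<Longrightarrow> v (\<gamma> s) \<le> u (\<gamma> s)"
    using maximal_network_subsolution by blast
  have sub: "arc_subsolution lam (H \<gamma>) (u \<circ> \<gamma>)" if "\<gamma> \<in> A" for \<gamma>
    using u that by (simp add: network_subsolution_def)
  have no_bump: "b \<gamma> s \<le> u (\<gamma> s)"
    if b: "\<And>\<gamma>. \<gamma> \<in> A \<Longrightarrow> arc_subsolution lam (H \<gamma>) (b \<gamma>)"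
      "\<And>\<gamma> s. \<gamma> \<in> A \<Longrightarrow> s \<in> {0..1} \<Longrightarrow> u (\<gamma> s) \<le> b \<gamma> s"
      "\<And>\<gamma>. \<gamma> \<in> A \<Longrightarrow> b \<gamma> 0 = u (\<gamma> 0)" "\<And>\<gamma>. \<gamma> \<in> A \<Longrightarrow> b \<gamma> 1 = c (\<gamma> 1)"
      and "\<gamma> \<in> A" "s \<in> {0..1}" for b c \<gamma> s
  proof -
    obtain v where v: "network_subsolution lam A H v"
      "\<And>\<gamma> s. \<gamma> \<in> A \<Longrightarrow> s \<in> {0..1} \<Longrightarrow> b \<gamma> s \<le> v (\<gamma> s)"
      using raise_network_subsolution[of u b c, OF u b] by blast
    have "u (\<gamma> s) \<le> v (\<gamma> s)" if "\<gamma> \<in> A" "s \<in> {0..1}" for \<gamma> s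
      using b(2)[OF that] v(2)[OF that] by linarith
    then have "u y \<le> v y" if "y \<in> carrier_of A" for y
      using that by (auto simp: carrier_eq)
    then show ?thesis
      using maximal[OF v(1)] v(2) \<open>\<gamma> \<in> A\<close> \<open>s \<in> {0..1}\<close> by (meson order_trans)
  qed
  have "arc_supersolution lam (H \<gamma>) (u \<circ> \<gamma>)" if \<gamma>: "\<gamma> \<in> A" for \<gamma>
  proof (rule ccontr)
    assume *: "\<not> arc_supersolution lam (H \<gamma>) (u \<circ> \<gamma>)"
    interpret discounted_arc lam "H \<gamma>" using \<gamma> by (rule discounted_arc)
    obtain v s where v: "arc_subsolution lam (H \<gamma>) v" "\<And>t. (u \<circ> \<gamma>) t \<le> v t"
      "v 0 = (u \<circ> \<gamma>) 0" "v 1 = (u \<circ> \<gamma>) 1" "s \<in> {0<..<1}" "(u \<circ> \<gamma>) s < v s"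
      using interior_bump[OF sub[OF \<gamma>] *] by blast
    define b where "b \<gamma>' = (if \<gamma>' = \<gamma> then v else u \<circ> \<gamma>')" for \<gamma>'
    have "b \<gamma> s \<le> u (\<gamma> s)"
      by (rule no_bump[where c=u]) (use v \<gamma> sub in \<open>auto simp: b_def\<close>)
    then show False using v(6) by (simp add: b_def)
  qed
  moreover have "\<exists>\<gamma>\<in>A. \<gamma> 1 = x \<and> state_constraint_at_1 lam (H \<gamma>) (u \<circ> \<gamma>)" if "x \<in> vertices A" for x
  proof (rule ccontr)
    assume *: "\<not> ?thesis"
    \<comment> \<open>The heights are written as \<open>1/y\<close>, so that a common height for all arcs is a large \<open>y\<close>.\<close>
    have "\<exists>\<eta>0. \<forall>\<gamma>\<in>A. \<forall>y\<ge>\<eta>0. y > 0 \<and> (\<gamma> 1 = x \<longrightarrow> (\<exists>v. arc_subsolution lam (H \<gamma>) v \<and>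
        (\<forall>t. (u \<circ> \<gamma>) t \<le> v t) \<and> v 0 = (u \<circ> \<gamma>) 0 \<and> v 1 = (u \<circ> \<gamma>) 1 + 1/y))"
    proof (rule uniform_over_arcs)
      fix \<gamma> assume \<gamma>: "\<gamma> \<in> A"
      then interpret discounted_arc lam "H \<gamma>" by (rule discounted_arc)
      show "\<exists>\<eta>0. \<forall>y\<ge>\<eta>0. y > 0 \<and> (\<gamma> 1 = x \<longrightarrow> (\<exists>v. arc_subsolution lam (H \<gamma>) v \<and>
        (\<forall>t. (u \<circ> \<gamma>) t \<le> v t) \<and> v 0 = (u \<circ> \<gamma>) 0 \<and> v 1 = (u \<circ> \<gamma>) 1 + 1/y))"
      proof (cases "\<gamma> 1 = x")
        case True
        then have "\<not> state_constraint_at_1 lam (H \<gamma>) (u \<circ> \<gamma>)" using * \<gamma> by blast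
        then obtain \<eta>0 where \<eta>0: "\<eta>0 > 0" "\<And>\<eta>. 0 < \<eta> \<Longrightarrow> \<eta> \<le> \<eta>0 \<Longrightarrow>
            \<exists>v. arc_subsolution lam (H \<gamma>) v \<and> (\<forall>t. (u \<circ> \<gamma>) t \<le> v t) \<and>
              v 0 = (u \<circ> \<gamma>) 0 \<and> v 1 = (u \<circ> \<gamma>) 1 + \<eta>"
          using endpoint_bump[OF sub[OF \<gamma>]] by blast
        show ?thesis
        proof (intro exI[of _ "1 / \<eta>0"] allI impI conjI)
          fix y assume y: "1 / \<eta>0 \<le> y"
          moreover have "1 / \<eta>0 > 0" using \<eta>0(1) by simp
          ultimately show "y > 0" by linarith
          then have "0 < 1/y" "1/y \<le> \<eta>0" using y \<eta>0(1) by (auto simp: field_simps)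
          then show "\<exists>v. arc_subsolution lam (H \<gamma>) v \<and> (\<forall>t. (u \<circ> \<gamma>) t \<le> v t) \<and>
              v 0 = (u \<circ> \<gamma>) 0 \<and> v 1 = (u \<circ> \<gamma>) 1 + 1/y"
            by (rule \<eta>0(2))
        qed
      qed (auto intro: exI[of _ 1])
    qed
    then obtain y where y: "\<And>\<gamma>. \<gamma> \<in> A \<Longrightarrow> y > 0" "\<And>\<gamma>. \<gamma> \<in> A \<Longrightarrow> \<gamma> 1 = x \<Longrightarrow>
        \<exists>v. arc_subsolution lam (H \<gamma>) v \<and> (\<forall>t. (u \<circ> \<gamma>) t \<le> v t) \<and>
          v 0 = (u \<circ> \<gamma>) 0 \<and> v 1 = (u \<circ> \<gamma>) 1 + 1/y" by blast
    define c where "c z = u z + (if z = x then 1/y else 0)" for z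
    have "\<forall>\<gamma>\<in>A. \<exists>v. arc_subsolution lam (H \<gamma>) v \<and> (\<forall>t. u (\<gamma> t) \<le> v t) \<and>
        v 0 = u (\<gamma> 0) \<and> v 1 = c (\<gamma> 1)"
    proof
      fix \<gamma> assume \<gamma>: "\<gamma> \<in> A"
      show "\<exists>v. arc_subsolution lam (H \<gamma>) v \<and> (\<forall>t. u (\<gamma> t) \<le> v t) \<and> v 0 = u (\<gamma> 0) \<and> v 1 = c (\<gamma> 1)"
        using y(2)[OF \<gamma>] sub[OF \<gamma>] by (cases "\<gamma> 1 = x") (auto simp: c_def intro: exI[of _ "u \<circ> \<gamma>"])
    qed
    then obtain b where b: "\<And>\<gamma>. \<gamma> \<in> A \<Longrightarrow> arc_subsolution lam (H \<gamma>) (b \<gamma>)"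
      "\<And>\<gamma> t. \<gamma> \<in> A \<Longrightarrow> u (\<gamma> t) \<le> b \<gamma> t"
      "\<And>\<gamma>. \<gamma> \<in> A \<Longrightarrow> b \<gamma> 0 = u (\<gamma> 0)" "\<And>\<gamma>. \<gamma> \<in> A \<Longrightarrow> b \<gamma> 1 = c (\<gamma> 1)"
      by metis
    obtain \<gamma> where \<gamma>: "\<gamma> \<in> A" "\<gamma> 1 = x" using \<open>x \<in> vertices A\<close> by (auto simp: vertices_eq)
    have "b \<gamma> 1 \<le> u (\<gamma> 1)" by (rule no_bump[where c=c]) (use b \<gamma> in auto)
    moreover have "b \<gamma> 1 = u (\<gamma> 1) + 1/y" using b(4) \<gamma> by (simp add: c_def)
    ultimately show False using y(1)[OF \<gamma>(1)] by simp
  qed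
  ultimately have "network_solution lam A H u"
    using u by (auto simp: network_solution_def network_supersolution_def network_subsolution_def)
  then show ?thesis by blast
qed

section \<open>Comparison on the network\<close>

text \<open>
  At a maximum point of \<open>u - v\<close> that is a vertex, one is free to look along the arc on which \<open>v\<close>
  satisfies the state constraint, so the one-dimensional comparison applies in every case.
\<close>

lemma network_comparison:
  assumes u: "network_subsolution lam A H u" and v: "network_supersolution lam A H v"
    and y: "y \<in> carrier_of A"
  shows "u y \<le> v y"
proof -
  have "compact (carrier_of A)"
    unfolding carrier_eq using finite_arcs arc_continuous by (intro compact_UN compact_continuous_image) auto
  moreover have "continuous_on (carrier_of A) (\<lambda>y. u y - v y)"
    using u v by (intro continuous_intros) (auto simp: network_subsolution_def network_supersolution_def)
  ultimately obtain x where x: "x \<in> carrier_of A" "\<And>z. z \<in> carrier_of A \<Longrightarrow> u z - v z \<le> u x - v x"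
    using continuous_attains_sup[of "carrier_of A" "\<lambda>y. u y - v y"] y by blast
  obtain \<gamma> s where \<gamma>: "\<gamma> \<in> A" "s \<in> {0<..1}" "\<gamma> s = x"
    and sc: "s = 1 \<Longrightarrow> state_constraint_at_1 lam (H \<gamma>) (v \<circ> \<gamma>)"
  proof (cases "x \<in> vertices A")
    case True
    then obtain \<gamma> where "\<gamma> \<in> A" "\<gamma> 1 = x" "state_constraint_at_1 lam (H \<gamma>) (v \<circ> \<gamma>)"
      using v by (auto simp: network_supersolution_def)
    then show ?thesis by (intro that[of \<gamma> 1]) auto
  next
    case False
    obtain \<gamma> s where *: "\<gamma> \<in> A" "s \<in> {0..1}" "\<gamma> s = x" using x(1) by (auto simp: carrier_eq)
    then have "s \<noteq> 0" "s \<noteq> 1" using False start_in_vertices finish_in_vertices by auto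
    then show ?thesis using * by (intro that[of \<gamma> s]) auto
  qed
  interpret discounted_arc lam "H \<gamma>" using \<gamma>(1) by (rule discounted_arc)
  have "(u \<circ> \<gamma>) s \<le> (v \<circ> \<gamma>) s"
  proof (rule comparison_at_maximum[OF _ _ \<gamma>(2) sc])
    show "(u \<circ> \<gamma>) t - (v \<circ> \<gamma>) t \<le> (u \<circ> \<gamma>) s - (v \<circ> \<gamma>) s" if "t \<in> {0..1}" for t
      using x(2)[OF arc_in_carrier[OF \<gamma>(1) that]] \<gamma>(3) by simp
    show "arc_subsolution lam (H \<gamma>) (u \<circ> \<gamma>)" "arc_supersolution lam (H \<gamma>) (v \<circ> \<gamma>)"
      using u v \<gamma>(1) unfolding network_subsolution_def network_supersolution_def by blast+
  qed
  then show ?thesis using x(2)[OF y] \<gamma>(3) by simp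
qed

end

section \<open>Edge paths and their fixed points\<close>

lemma edge_path_Cons:
  "edge_path E \<Psi> x (e # \<xi>) y \<longleftrightarrow>
    e \<in> E \<and> \<Psi> e 0 = x \<and> (if \<xi> = [] then \<Psi> e 1 = y else edge_path E \<Psi> (\<Psi> e 1) \<xi> y)"
  by (cases \<xi>) (auto simp: edge_path_def chain_from_to_def)

lemma not_edge_path_Nil: "\<not> edge_path E \<Psi> x [] y"
  by (simp add: edge_path_def chain_from_to_def)

lemma edge_path_set: "edge_path E \<Psi> x \<xi> y \<Longrightarrow> \<xi> \<noteq> [] \<and> set \<xi> \<subseteq> E"
  by (simp add: edge_path_def chain_from_to_def)

lemma rho_path_simps [simp]:
  "rho_path lam H \<Psi> \<alpha> [] = \<alpha>"
  "rho_path lam H \<Psi> \<alpha> (e # \<xi>) = rho_path lam H \<Psi> (rho lam H \<Psi> \<alpha> e) \<xi>"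
  by (simp_all add: rho_path_def)

locale network_graph = discounted_network A H lam
  for A :: "(real \<Rightarrow> real^'n) set" and H lam +
  fixes E :: "'e set" and \<Psi> :: "'e \<Rightarrow> real \<Rightarrow> real^'n"
  assumes edges: "bij_betw \<Psi> E A"
begin

lemma edge_arc: "e \<in> E \<Longrightarrow> \<Psi> e \<in> A"
  and arc_edge: "\<gamma> \<in> A \<Longrightarrow> \<exists>e\<in>E. \<Psi> e = \<gamma>"
  using edges by (auto simp: bij_betw_def)

lemma edge_discounted_arc: "e \<in> E \<Longrightarrow> discounted_arc lam (H (\<Psi> e))"
  by (intro discounted_arc edge_arc)

lemma rho_mono: "e \<in> E \<Longrightarrow> \<alpha> \<le> \<alpha>' \<Longrightarrow> rho lam H \<Psi> \<alpha> e \<le> rho lam H \<Psi> \<alpha>' e"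
  unfolding rho_def by (intro discounted_arc.terminal_value_mono edge_discounted_arc)

lemma rho_strict_contraction:
  "e \<in> E \<Longrightarrow> \<alpha> < \<alpha>' \<Longrightarrow> rho lam H \<Psi> \<alpha>' e - rho lam H \<Psi> \<alpha> e < \<alpha>' - \<alpha>"
  unfolding rho_def by (intro discounted_arc.terminal_value_strict_contraction edge_discounted_arc)

text \<open>
  Two uniform facts about all edges: \<open>rho\<close> does not decrease very low values, by the constant
  subsolutions, and it is bounded above. They trap the fixed points of paths.
\<close>

lemma rho_bounds:
  obtains a where "\<And>\<alpha> e. e \<in> E \<Longrightarrow> \<alpha> \<le> - a \<Longrightarrow> \<alpha> \<le> rho lam H \<Psi> \<alpha> e"
    "\<And>\<alpha> e. e \<in> E \<Longrightarrow> rho lam H \<Psi> \<alpha> e \<le> a"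
proof -
  have "\<exists>a. \<forall>\<gamma>\<in>A. \<forall>x\<ge>a. (\<forall>\<alpha>\<le>- x. \<alpha> \<le> max_subsolution lam (H \<gamma>) \<alpha> 1) \<and>
      (\<forall>\<alpha>. max_subsolution lam (H \<gamma>) \<alpha> 1 \<le> x)"
  proof (rule uniform_over_arcs)
    fix \<gamma> assume "\<gamma> \<in> A"
    then interpret discounted_arc lam "H \<gamma>" by (rule discounted_arc)
    obtain a b where ab: "\<And>\<alpha>. \<alpha> \<le> a \<Longrightarrow> \<alpha> \<le> max_subsolution lam (H \<gamma>) \<alpha> 1"
      "\<And>\<alpha>. max_subsolution lam (H \<gamma>) \<alpha> 1 \<le> b"
      using terminal_value_bounds by blast
    show "\<exists>a. \<forall>x\<ge>a. (\<forall>\<alpha>\<le>- x. \<alpha> \<le> max_subsolution lam (H \<gamma>) \<alpha> 1) \<and>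
        (\<forall>\<alpha>. max_subsolution lam (H \<gamma>) \<alpha> 1 \<le> x)"
    proof (intro exI[of _ "max (- a) b"] allI impI conjI)
      fix x \<alpha> assume x: "max (- a) b \<le> x"
      show "max_subsolution lam (H \<gamma>) \<alpha> 1 \<le> x" using ab(2)[of \<alpha>] x by simp
      show "\<alpha> \<le> max_subsolution lam (H \<gamma>) \<alpha> 1" if "\<alpha> \<le> - x" using ab(1)[of \<alpha>] x that by simp
    qed
  qed
  then show ?thesis using that edge_arc unfolding rho_def by blast
qed

lemma rho_path_mono:
  "set \<xi> \<subseteq> E \<Longrightarrow> \<alpha> \<le> \<alpha>' \<Longrightarrow> rho_path lam H \<Psi> \<alpha> \<xi> \<le> rho_path lam H \<Psi> \<alpha>' \<xi>"
proof (induction \<xi> arbitrary: \<alpha> \<alpha>')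
  case (Cons e \<xi>)
  then show ?case using rho_mono[of e \<alpha> \<alpha>'] by simp
qed simp

lemma rho_path_strict_contraction:
  assumes "\<xi> \<noteq> []" "set \<xi> \<subseteq> E" "\<alpha> < \<alpha>'"
  shows "rho_path lam H \<Psi> \<alpha>' \<xi> - rho_path lam H \<Psi> \<alpha> \<xi> < \<alpha>' - \<alpha>"
  using assms
proof (induction \<xi> arbitrary: \<alpha> \<alpha>')
  case (Cons e \<xi>)
  let ?r = "\<lambda>\<alpha>. rho lam H \<Psi> \<alpha> e"
  have step: "?r \<alpha>' - ?r \<alpha> < \<alpha>' - \<alpha>" using Cons.prems by (intro rho_strict_contraction) auto
  have "rho_path lam H \<Psi> (?r \<alpha>') \<xi> - rho_path lam H \<Psi> (?r \<alpha>) \<xi> \<le> ?r \<alpha>' - ?r \<alpha>"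
  proof (cases "\<xi> = [] \<or> ?r \<alpha> = ?r \<alpha>'")
    case False
    have "?r \<alpha> \<le> ?r \<alpha>'" using Cons.prems by (intro rho_mono) auto
    then show ?thesis using Cons.IH[of "?r \<alpha>" "?r \<alpha>'"] Cons.prems False by auto
  qed auto
  then show ?case using step by simp
qed simp

lemma rho_path_continuous:
  assumes "\<xi> \<noteq> []" "set \<xi> \<subseteq> E"
  shows "continuous_on UNIV (\<lambda>\<alpha>. rho_path lam H \<Psi> \<alpha> \<xi>)"
proof -
  have *: "\<bar>rho_path lam H \<Psi> \<alpha> \<xi> - rho_path lam H \<Psi> \<alpha>' \<xi>\<bar> \<le> \<bar>\<alpha> - \<alpha>'\<bar>" if "\<alpha> < \<alpha>'" for \<alpha> \<alpha>'
    using rho_path_strict_contraction[OF assms that] rho_path_mono[OF assms(2), of \<alpha> \<alpha>'] that by auto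
  have "1-lipschitz_on UNIV (\<lambda>\<alpha>. rho_path lam H \<Psi> \<alpha> \<xi>)"
  proof (rule lipschitz_onI)
    show "dist (rho_path lam H \<Psi> \<alpha> \<xi>) (rho_path lam H \<Psi> \<alpha>' \<xi>) \<le> 1 * dist \<alpha> \<alpha>'" for \<alpha> \<alpha>'
      using *[of \<alpha> \<alpha>'] *[of \<alpha>' \<alpha>]
      by (cases \<alpha> \<alpha>' rule: linorder_cases) (auto simp: dist_real_def abs_minus_commute)
  qed simp
  then show ?thesis by (rule lipschitz_on_continuous_on)
qed

text \<open>
  By \<open>rho_bounds\<close> the map does not lie below the diagonal at \<open>- a\<close>, nor above it at \<open>b\<close>, so it
  meets the diagonal in between.
\<close>

lemma rho_path_fixed_point:
  assumes "\<xi> \<noteq> []" "set \<xi> \<subseteq> E"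
  shows "\<exists>\<alpha>. rho_path lam H \<Psi> \<alpha> \<xi> = \<alpha>"
proof -
  obtain a where a: "\<And>\<alpha> e. e \<in> E \<Longrightarrow> \<alpha> \<le> - a \<Longrightarrow> \<alpha> \<le> rho lam H \<Psi> \<alpha> e"
    "\<And>\<alpha> e. e \<in> E \<Longrightarrow> rho lam H \<Psi> \<alpha> e \<le> a"
    using rho_bounds by blast
  have lower: "\<alpha> \<le> rho_path lam H \<Psi> \<alpha> \<xi>" if "\<alpha> \<le> - a" "set \<xi> \<subseteq> E" for \<alpha> \<xi>
    using that(2)
  proof (induction \<xi>)
    case (Cons e \<xi>)
    have "rho_path lam H \<Psi> \<alpha> \<xi> \<le> rho_path lam H \<Psi> (rho lam H \<Psi> \<alpha> e) \<xi>"
      using Cons.prems a(1)[OF _ that(1)] by (intro rho_path_mono) auto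
    then show ?case using Cons by auto
  qed simp
  have upper: "rho_path lam H \<Psi> \<alpha> \<xi> \<le> a" for \<alpha>
    using assms
    by (induction \<xi> arbitrary: \<alpha> rule: list_nonempty_induct) (auto intro: a(2))
  define b where "b = max a (- a)"
  have "- rho_path lam H \<Psi> (- a) \<xi> + - a \<le> 0" "0 \<le> - rho_path lam H \<Psi> b \<xi> + b"
    using lower[OF order_refl assms(2)] upper[of b] by (auto simp: b_def max_def)
  moreover have "continuous_on {- a..b} (\<lambda>\<alpha>. - rho_path lam H \<Psi> \<alpha> \<xi> + \<alpha>)"
    by (intro continuous_intros continuous_on_subset[OF rho_path_continuous[OF assms]]) auto
  ultimately have "\<exists>x\<ge>- a. x \<le> b \<and> - rho_path lam H \<Psi> x \<xi> + x = 0"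
    by (intro IVT') (auto simp: b_def)
  then obtain x where "- rho_path lam H \<Psi> x \<xi> + x = 0" by blast
  then show ?thesis by (intro exI[of _ x]) linarith
qed

lemma rho_path_fixed_point_unique:
  assumes "\<xi> \<noteq> []" "set \<xi> \<subseteq> E"
    and "rho_path lam H \<Psi> \<alpha> \<xi> = \<alpha>" "\<alpha>' \<le> rho_path lam H \<Psi> \<alpha>' \<xi>"
  shows "\<alpha>' \<le> \<alpha>"
  using rho_path_strict_contraction[OF assms(1,2), of \<alpha> \<alpha>'] assms(3,4) by linarith

lemma beta_eq:
  assumes "\<xi> \<noteq> []" "set \<xi> \<subseteq> E" "rho_path lam H \<Psi> \<alpha> \<xi> = \<alpha>"
  shows "beta lam H \<Psi> \<xi> = \<alpha>"
  unfolding beta_def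
proof (rule the_equality)
  fix \<alpha>' assume *: "rho_path lam H \<Psi> \<alpha>' \<xi> = \<alpha>'"
  show "\<alpha>' = \<alpha>"
    using rho_path_fixed_point_unique[OF assms(1,2) * ] rho_path_fixed_point_unique[OF assms] * assms(3)
    by (simp add: order_antisym)
qed fact

text \<open>
  Above its fixed point a strict contraction lies strictly below the diagonal.
\<close>

lemma le_beta:
  assumes "\<xi> \<noteq> []" "set \<xi> \<subseteq> E" "\<alpha> \<le> rho_path lam H \<Psi> \<alpha> \<xi>"
  shows "\<alpha> \<le> beta lam H \<Psi> \<xi>"
proof -
  obtain \<alpha>' where *: "rho_path lam H \<Psi> \<alpha>' \<xi> = \<alpha>'" using rho_path_fixed_point[OF assms(1,2)] by blast
  show ?thesis
    using rho_path_fixed_point_unique[OF assms(1,2) * assms(3)] beta_eq[OF assms(1,2) *] by simp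
qed

section \<open>The vertex values of a solution\<close>

lemma subsolution_le_rho_path:
  assumes u: "network_subsolution lam A H u" and \<xi>: "edge_path E \<Psi> x \<xi> y"
  shows "u y \<le> rho_path lam H \<Psi> (u x) \<xi>"
  using \<xi>
proof (induction \<xi> arbitrary: x)
  case (Cons e \<xi>)
  have e: "e \<in> E" "\<Psi> e 0 = x" using Cons.prems by (auto simp: edge_path_Cons)
  have "arc_subsolution lam (H (\<Psi> e)) (u \<circ> \<Psi> e)"
    using u edge_arc[OF e(1)] unfolding network_subsolution_def by blast
  then have "(u \<circ> \<Psi> e) 1 \<le> max_subsolution lam (H (\<Psi> e)) (u x) 1"
    using e(2) by (intro discounted_arc.terminal_value_upper edge_discounted_arc e(1)) (auto simp: o_def)
  then have step: "u (\<Psi> e 1) \<le> rho lam H \<Psi> (u x) e" by (simp add: rho_def)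
  show ?case
  proof (cases "\<xi> = []")
    case True
    then show ?thesis using step Cons.prems by (simp add: edge_path_Cons)
  next
    case False
    then have \<xi>: "edge_path E \<Psi> (\<Psi> e 1) \<xi> y" using Cons.prems by (simp add: edge_path_Cons)
    have "rho_path lam H \<Psi> (u (\<Psi> e 1)) \<xi> \<le> rho_path lam H \<Psi> (rho lam H \<Psi> (u x) e) \<xi>"
      using edge_path_set[OF \<xi>] step by (intro rho_path_mono) auto
    then show ?thesis using Cons.IH[OF \<xi>] by simp
  qed
qed (simp add: not_edge_path_Nil)

lemma subsolution_le_beta:
  assumes "network_subsolution lam A H u" "edge_path E \<Psi> x \<xi> x"
  shows "u x \<le> beta lam H \<Psi> \<xi>"
  using edge_path_set[OF assms(2)] by (intro le_beta subsolution_le_rho_path assms) auto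

text \<open>
  The path \<open>\<xi>\<close> serves to produce an edge leaving \<open>x\<close>: this edge followed by its inverse is a cycle,
  so the infimum is over a nonempty set.
\<close>

lemma subsolution_le_cycle_inf:
  assumes "network_subsolution lam A H u" "edge_path E \<Psi> x \<xi> y"
  shows "u x \<le> cycle_inf lam H E \<Psi> x"
  unfolding cycle_inf_def
proof (rule cInf_greatest)
  obtain e where e: "e \<in> E" "\<Psi> e 0 = x"
    using assms(2) by (cases \<xi>) (auto simp: edge_path_Cons not_edge_path_Nil)
  obtain e' where e': "e' \<in> E" "\<Psi> e' = inverse_arc (\<Psi> e)"
    using arc_edge[OF inverse_arc_in[OF edge_arc[OF e(1)]]] by blast
  have "edge_path E \<Psi> x [e, e'] x" using e e' by (simp add: edge_path_Cons inverse_arc_apply)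
  then show "{beta lam H \<Psi> \<xi> |\<xi>. edge_path E \<Psi> x \<xi> x} \<noteq> {}" by blast
qed (use subsolution_le_beta[OF assms(1)] in auto)

lemma subsolution_le_competitor:
  assumes "network_subsolution lam A H u" "edge_path E \<Psi> y \<xi> x"
  shows "u x \<le> rho_path lam H \<Psi> (cycle_inf lam H E \<Psi> y) \<xi>"
proof -
  have "u x \<le> rho_path lam H \<Psi> (u y) \<xi>" by (rule subsolution_le_rho_path[OF assms])
  also have "\<dots> \<le> rho_path lam H \<Psi> (cycle_inf lam H E \<Psi> y) \<xi>"
    using edge_path_set[OF assms(2)] subsolution_le_cycle_inf[OF assms] by (intro rho_path_mono) auto
  finally show ?thesis .
qed

text \<open>
  Along an arc with the state constraint, \<open>u\<close> dominates by comparison every subsolution that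
  starts no higher, and is itself one of them: it is the largest one at the terminal point.
\<close>

lemma solution_optimal_edge:
  assumes u: "network_solution lam A H u" and x: "x \<in> vertices A"
  obtains e where "e \<in> E" "\<Psi> e 1 = x" "rho lam H \<Psi> (u (\<Psi> e 0)) e = u x"
proof -
  obtain \<gamma> where \<gamma>: "\<gamma> \<in> A" "\<gamma> 1 = x" "state_constraint_at_1 lam (H \<gamma>) (u \<circ> \<gamma>)"
    using u x by (auto simp: network_solution_def network_supersolution_def)
  obtain e where e: "e \<in> E" "\<Psi> e = \<gamma>" using arc_edge[OF \<gamma>(1)] by blast
  interpret discounted_arc lam "H \<gamma>" using \<gamma>(1) by (rule discounted_arc)
  have sub: "arc_subsolution lam (H \<gamma>) (u \<circ> \<gamma>)" and super: "arc_supersolution lam (H \<gamma>) (u \<circ> \<gamma>)"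
    using u \<gamma>(1) unfolding network_solution_def network_subsolution_def network_supersolution_def by blast+
  have "rho lam H \<Psi> (u (\<Psi> e 0)) e \<le> u x"
    unfolding rho_def e(2)
    using comparison_from_left_endpoint[OF _ super \<gamma>(3)] \<gamma>(2) by (intro terminal_value_least) auto
  moreover have "u x \<le> rho lam H \<Psi> (u (\<Psi> e 0)) e"
    unfolding rho_def e(2) using terminal_value_upper[OF sub] \<gamma>(2) by auto
  ultimately show ?thesis using that e \<gamma>(2) by auto
qed

lemma solution_vertex_value:
  assumes u: "network_solution lam A H u" and x: "x \<in> vertices A"
  shows "u x = vertex_value lam H E \<Psi> x"
proof -
  have sub: "network_subsolution lam A H u" using u by (simp add: network_solution_def)
  have "\<forall>x\<in>vertices A. \<exists>e\<in>E. \<Psi> e 1 = x \<and> rho lam H \<Psi> (u (\<Psi> e 0)) e = u x"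
    using solution_optimal_edge[OF u] by blast
  then obtain g where g: "\<And>x. x \<in> vertices A \<Longrightarrow> g x \<in> E" "\<And>x. x \<in> vertices A \<Longrightarrow> \<Psi> (g x) 1 = x"
    "\<And>x. x \<in> vertices A \<Longrightarrow> rho lam H \<Psi> (u (\<Psi> (g x) 0)) (g x) = u x"
    by metis
  define X where "X n = ((\<lambda>x. \<Psi> (g x) 0) ^^ n) x" for n
  have X: "X n \<in> vertices A" for n
    by (induction n) (auto simp: X_def x intro: start_in_vertices[OF edge_arc[OF g(1)]])
  \<comment> \<open>Walking backwards along optimal edges, \<open>u\<close> is transported without loss.\<close>
  have backward: "\<exists>\<xi>. edge_path E \<Psi> (X n) \<xi> (X m) \<and> rho_path lam H \<Psi> (u (X n)) \<xi> = u (X m)" if "m < n" for m n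
    using that
  proof (induction n)
    case (Suc n)
    have edge: "g (X n) \<in> E" "\<Psi> (g (X n)) 0 = X (Suc n)" "\<Psi> (g (X n)) 1 = X n"
      "rho lam H \<Psi> (u (X (Suc n))) (g (X n)) = u (X n)"
      using g X[of n] by (auto simp: X_def)
    show ?case
    proof (cases "m = n")
      case True
      then show ?thesis using edge by (intro exI[of _ "[g (X n)]"]) (simp add: edge_path_Cons)
    next
      case False
      then obtain \<xi> where \<xi>: "edge_path E \<Psi> (X n) \<xi> (X m)" "rho_path lam H \<Psi> (u (X n)) \<xi> = u (X m)"
        using Suc by auto
      then show ?thesis
        using edge edge_path_set[OF \<xi>(1)]
        by (intro exI[of _ "g (X n) # \<xi>"]) (simp add: edge_path_Cons)
    qed
  qed simp
  \<comment> \<open>The backward walk revisits a vertex, which closes a cycle \<open>\<zeta>\<close> with fixed point \<open>u (X n)\<close>.\<close>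
  have "finite (vertices A)" using finite_arcs by (simp add: vertices_eq)
  then have "\<not> inj X"
    using X finite_subset[of "range X" "vertices A"] finite_imageD[of X UNIV] infinite_UNIV_nat by auto
  then obtain m n where mn: "m < n" "X m = X n"
    unfolding inj_def by (metis linorder_neq_iff)
  obtain \<zeta> where \<zeta>: "edge_path E \<Psi> (X n) \<zeta> (X n)" "rho_path lam H \<Psi> (u (X n)) \<zeta> = u (X n)"
    using backward[OF mn(1)] mn(2) by auto
  have "cycle_inf lam H E \<Psi> (X n) \<le> beta lam H \<Psi> \<zeta>"
    unfolding cycle_inf_def
    by (rule cInf_lower)
       (use \<zeta>(1) subsolution_le_beta[OF sub] in \<open>auto intro!: bdd_belowI[of _ "u (X n)"]\<close>)
  also have "\<dots> = u (X n)" using edge_path_set[OF \<zeta>(1)] \<zeta>(2) by (intro beta_eq) auto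
  finally have f: "cycle_inf lam H E \<Psi> (X n) = u (X n)"
    using subsolution_le_cycle_inf[OF sub \<zeta>(1)] by simp
  \<comment> \<open>The same walk connects the base of the cycle with \<open>x\<close>; \<open>n > 0\<close> makes this path nonempty.\<close>
  obtain \<xi> where \<xi>: "edge_path E \<Psi> (X n) \<xi> x" "rho_path lam H \<Psi> (u (X n)) \<xi> = u x"
    using backward[of 0 n] mn(1) by (auto simp: X_def)
  let ?S = "{rho_path lam H \<Psi> (cycle_inf lam H E \<Psi> y) \<xi> |y \<xi>. edge_path E \<Psi> y \<xi> x}"
  have "u x \<in> ?S" using \<xi> f by (auto intro!: exI[of _ "X n"] exI[of _ \<xi>])
  moreover have "u x \<le> z" if "z \<in> ?S" for z
    using that subsolution_le_competitor[OF sub] by blast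
  ultimately have "Inf ?S = u x" by (rule cInf_eq_minimum)
  then show ?thesis by (simp add: vertex_value_def)
qed

end

section \<open>Existence, uniqueness and the vertex values\<close>

text \<open>
  Being a solution depends on the values on the network only, so the solution may be taken in
  \<^term>\<open>extensional (carrier_of A)\<close>, the set in which uniqueness is meaningful.
\<close>

lemma (in discounted_network) network_solution_cong:
  assumes u: "network_solution lam A H u" and eq: "\<And>y. y \<in> carrier_of A \<Longrightarrow> u y = v y"
  shows "network_solution lam A H v"
proof -
  have on_arc: "(u \<circ> \<gamma>) s = (v \<circ> \<gamma>) s" if "\<gamma> \<in> A" "s \<in> {0..1}" for \<gamma> s
    using eq[OF arc_in_carrier[OF that]] by simp
  have cont: "continuous_on (carrier_of A) v"
    by (rule continuous_on_eq[OF _ eq])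
       (use u in \<open>simp_all add: network_solution_def network_subsolution_def\<close>)
  have "arc_subsolution lam (H \<gamma>) (v \<circ> \<gamma>)" if "\<gamma> \<in> A" for \<gamma>
    by (rule arc_subsolution_cong[where w="u \<circ> \<gamma>" and h="H \<gamma>"])
       (use u that on_arc in \<open>simp_all add: network_solution_def network_subsolution_def\<close>)
  moreover have "arc_supersolution lam (H \<gamma>) (v \<circ> \<gamma>)" if "\<gamma> \<in> A" for \<gamma>
    by (rule arc_supersolution_cong[where w="u \<circ> \<gamma>"])
       (use u that on_arc in \<open>simp_all add: network_solution_def network_supersolution_def\<close>)
  moreover have "\<exists>\<gamma>\<in>A. \<gamma> 1 = x \<and> state_constraint_at_1 lam (H \<gamma>) (v \<circ> \<gamma>)" if x: "x \<in> vertices A" for x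
  proof -
    obtain \<gamma> where \<gamma>: "\<gamma> \<in> A" "\<gamma> 1 = x" "state_constraint_at_1 lam (H \<gamma>) (u \<circ> \<gamma>)"
      using u x by (auto simp: network_solution_def network_supersolution_def)
    have "state_constraint_at_1 lam (H \<gamma>) (v \<circ> \<gamma>)"
      by (rule state_constraint_at_1_cong[OF on_arc[OF \<gamma>(1)] \<gamma>(3)])
    then show ?thesis using \<gamma> by blast
  qed
  ultimately show ?thesis
    using cont by (simp add: network_solution_def network_subsolution_def network_supersolution_def)
qed

theorem theorem6p6:
  fixes A :: "(real \<Rightarrow> real^'n) set"
    and H :: "(real \<Rightarrow> real^'n) \<Rightarrow> real \<Rightarrow> real \<Rightarrow> real"
    and E :: "'e set"
    and \<Psi> :: "'e \<Rightarrow> real \<Rightarrow> real^'n"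
    and lam :: real
  assumes "network A"
    and "hamiltonians A H"
    and "bij_betw \<Psi> E A"
    and "lam > 0"
  shows "(\<exists>!u. u \<in> extensional (carrier_of A) \<and> network_solution lam A H u) \<and>
         (\<forall>u. network_solution lam A H u \<longrightarrow>
            (\<forall>x\<in>vertices A. u x = vertex_value lam H E \<Psi> x))"
proof
  interpret network_graph A H lam E \<Psi>
    using assms by (simp add: network_graph_def network_graph_axioms_def discounted_network_def)
  show "\<forall>u. network_solution lam A H u \<longrightarrow> (\<forall>x\<in>vertices A. u x = vertex_value lam H E \<Psi> x)"
    using solution_vertex_value by blast
  obtain u where u: "network_solution lam A H u" using network_solution_exists by blast
  define v where "v = restrict u (carrier_of A)"
  have v: "network_solution lam A H v"
  proof (rule network_solution_cong[OF u])
    show "u y = v y" if "y \<in> carrier_of A" for y using that by (simp add: v_def)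
  qed
  show "\<exists>!u. u \<in> extensional (carrier_of A) \<and> network_solution lam A H u"
  proof (rule ex1I[of _ v])
    fix w assume w: "w \<in> extensional (carrier_of A) \<and> network_solution lam A H w"
    show "w = v"
    proof (rule extensionalityI[of _ "carrier_of A"])
      show "w y = v y" if "y \<in> carrier_of A" for y
        using network_comparison[OF _ _ that, of w v] network_comparison[OF _ _ that, of v w] v w
        by (simp add: network_solution_def order_antisym)
    qed (use w in \<open>auto simp: v_def\<close>)
  qed (use v in \<open>simp add: v_def\<close>)
qed

end
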